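(* Let $K$ be an inversive difference field with basic set $\sigma=\{\alpha_1,\alpha_2\}$ whose elements are functions $f(x,t)$, with $\alpha_1:f(x,t)\mapsto f(x+1,t)$ and $\alpha_2:f(x,t)\mapsto f(x,t+1)$, and let $K\{y\}^*$ be the ring of $\sigma^*$-polynomials in one $\sigma^*$-indeterminate $y$ over $K$. Let $a,b,c\in K$ be constants with $c\neq0$ and $ab\ne0$, and let $F$ be a polynomial in one variable with coefficients in $K$. Consider the difference schemes for the reaction-diffusion equation $$\frac{\partial^2u}{\partial x^2}+(au+b)\frac{\partial u}{\partial x}+c\frac{\partial u}{\partial t}+F(u)=0.$$ (1) (Forward scheme.) With $G(y)=F(y)-ay^2-(b+c-1)y$, the $\sigma^*$-dimension polynomial of the equation $$\alpha_1^2y+(ay+b-2)\alpha_1y+c\,\alpha_2y+G(y)=0$$ is $\psi_{Forw}(t)=5t$. (2) (Symmetric scheme.) The $\sigma^*$-dimension polynomial of the equation $$(ay+b+1)\alpha_1y+(1-ay-b)\alpha_1^{-1}y+c\,\alpha_2y-c\,\alpha_2^{-1}y+F(y)-2y=0$$ is $\psi_{Symm}(t)=4t$.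
   Context: All fields have characteristic zero. An inversive difference field with basic set $\sigma=\{\alpha_1,\alpha_2\}$ is a field with commuting automorphisms $\alpha_1,\alpha_2$. A constant is an element fixed by $\alpha_1$ and $\alpha_2$. $\Gamma$ is the free commutative group of all $\gamma=\alpha_1^{k_1}\alpha_2^{k_2}$ ($k_i\in\mathbb Z$), $\mathrm{ord}\,\gamma=|k_1|+|k_2|$, and $\Gamma(r)=\{\gamma\in\Gamma:\mathrm{ord}\,\gamma\le r\}$. $K\{y_1,\dots,y_n\}^*$ is the polynomial ring over $K$ in the algebraically independent indeterminates $\gamma y_i$ ($\gamma\in\Gamma$, $1\le i\le n$), on which $\Gamma$ acts by $\gamma'(\gamma y_i)=(\gamma'\gamma)y_i$ and by the given action on coefficients. A system of equations $A_1=0,\dots,A_q=0$ with $A_i\in K\{y_1,\dots,y_n\}^*$ is prime if the ideal $P=[A_1,\dots,A_q]^*$ generated by all $\gamma A_i$ ($\gamma\in\Gamma$, $1\le i\le q$) is prime. Let then $L$ be the quotient field of $K\{y_1,\dots,y_n\}^*/P$ and $\eta_i$ the image of $y_i$. The $\sigma^*$-dimension polynomial of the system is the unique polynomial $\psi(t)\in\mathbb Q[t]$ such that $\psi(r)=\mathrm{tr.deg}_K K(\{\gamma\eta_i:\gamma\in\Gamma(r),\,1\le i\le n\})$ for all sufficiently large integers $r$ (it exists for every prime system). Saying that a system has a given $\sigma^*$-dimension polynomial includes the assertion that the system is prime. This polynomial expresses Einstein's strength of the system. *)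

theory Defs
  imports
    "HOL-Library.Poly_Mapping"
    "HOL-Library.Product_Plus"
    "HOL-Algebra.Generated_Fields"
    "HOL-Algebra.Algebraic_Closure_Type"
begin

section \<open>Quotient field of a domain\<close>

definition fraction_rel :: "('a, 'm) ring_scheme \<Rightarrow> (('a \<times> 'a) \<times> ('a \<times> 'a)) set"
  where "fraction_rel D = {((a, b), (c, d)). a \<in> carrier D \<and> b \<in> carrier D - {\<zero>\<^bsub>D\<^esub>} \<and>
           c \<in> carrier D \<and> d \<in> carrier D - {\<zero>\<^bsub>D\<^esub>} \<and> a \<otimes>\<^bsub>D\<^esub> d = c \<otimes>\<^bsub>D\<^esub> b}"

definition fraction :: "('a, 'm) ring_scheme \<Rightarrow> 'a \<Rightarrow> 'a \<Rightarrow> ('a \<times> 'a) set"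
  where "fraction D a b = fraction_rel D `` {(a, b)}"

definition quotient_field :: "('a, 'm) ring_scheme \<Rightarrow> ('a \<times> 'a) set ring"
  where "quotient_field D =
    \<lparr> carrier = {fraction D a b | a b. a \<in> carrier D \<and> b \<in> carrier D - {\<zero>\<^bsub>D\<^esub>}},
      monoid.mult = (\<lambda>p q. \<Union>(a, b)\<in>p. \<Union>(c, d)\<in>q. fraction D (a \<otimes>\<^bsub>D\<^esub> c) (b \<otimes>\<^bsub>D\<^esub> d)),
      monoid.one = fraction D \<one>\<^bsub>D\<^esub> \<one>\<^bsub>D\<^esub>,
      ring.zero = fraction D \<zero>\<^bsub>D\<^esub> \<one>\<^bsub>D\<^esub>,
      ring.add = (\<lambda>p q. \<Union>(a, b)\<in>p. \<Union>(c, d)\<in>q.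
               fraction D (a \<otimes>\<^bsub>D\<^esub> d \<oplus>\<^bsub>D\<^esub> c \<otimes>\<^bsub>D\<^esub> b) (b \<otimes>\<^bsub>D\<^esub> d)) \<rparr>"

context "domain"
begin

lemma fraction_rel_trans:
  assumes "((a, b), (c, d)) \<in> fraction_rel R" "((c, d), (e, f)) \<in> fraction_rel R"
  shows "((a, b), (e, f)) \<in> fraction_rel R"
proof -
  have mem: "a \<in> carrier R" "b \<in> carrier R" "c \<in> carrier R" "d \<in> carrier R" "e \<in> carrier R"
      "f \<in> carrier R" "b \<noteq> \<zero>" "d \<noteq> \<zero>" "f \<noteq> \<zero>"
    and 1: "a \<otimes> d = c \<otimes> b" and 2: "c \<otimes> f = e \<otimes> d"
    using assms by (auto simp: fraction_rel_def)
  have "d \<otimes> (a \<otimes> f) = (a \<otimes> d) \<otimes> f" using mem by (simp add: m_ac)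
  also have "\<dots> = (c \<otimes> f) \<otimes> b" using mem by (simp add: 1 m_ac)
  also have "\<dots> = d \<otimes> (e \<otimes> b)" using mem by (simp add: 2 m_ac)
  finally have "a \<otimes> f = e \<otimes> b"
    using mem m_lcancel[of d "a \<otimes> f" "e \<otimes> b"] by simp
  then show ?thesis using mem by (auto simp: fraction_rel_def)
qed

lemma equiv_fraction_rel:
  "equiv (carrier R \<times> (carrier R - {\<zero>})) (fraction_rel R)"
proof (rule equivI)
  show "fraction_rel R \<subseteq> (carrier R \<times> (carrier R - {\<zero>})) \<times> (carrier R \<times> (carrier R - {\<zero>}))"
    by (auto simp: fraction_rel_def)
  show "refl_on (carrier R \<times> (carrier R - {\<zero>})) (fraction_rel R)"
    by (auto simp: refl_on_def fraction_rel_def)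
  show "sym (fraction_rel R)"
    by (auto simp: sym_def fraction_rel_def)
  show "trans (fraction_rel R)"
    by (rule transI) (use fraction_rel_trans in auto)
qed

lemma fraction_eq_iff:
  assumes "a \<in> carrier R" "b \<in> carrier R - {\<zero>}" "c \<in> carrier R" "d \<in> carrier R - {\<zero>}"
  shows "fraction R a b = fraction R c d \<longleftrightarrow> a \<otimes> d = c \<otimes> b"
  using eq_equiv_class_iff[OF equiv_fraction_rel, of "(a, b)" "(c, d)"] assms
  by (auto simp: fraction_def fraction_rel_def)

lemma fraction_binop:
  assumes "a \<in> carrier R" "b \<in> carrier R - {\<zero>}" "c \<in> carrier R" "d \<in> carrier R - {\<zero>}"
    and "\<And>a b c d a' b' c' d'. ((a, b), (a', b')) \<in> fraction_rel R \<Longrightarrow>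
           ((c, d), (c', d')) \<in> fraction_rel R \<Longrightarrow> h a b c d = h a' b' c' d'"
  shows "(\<Union>(a, b)\<in>fraction R a b. \<Union>(c, d)\<in>fraction R c d. h a b c d) = h a b c d"
proof -
  have ab: "(a, b) \<in> fraction R a b" and cd: "(c, d) \<in> fraction R c d"
    using assms(1-4) by (auto simp: fraction_def fraction_rel_def)
  have eq: "h a' b' c' d' = h a b c d"
    if "(a', b') \<in> fraction R a b" "(c', d') \<in> fraction R c d" for a' b' c' d'
    using assms(5)[of a b a' b' c d c' d'] that by (simp add: fraction_def)
  have "(\<Union>(c', d')\<in>fraction R c d. h a' b' c' d') = h a b c d" if "(a', b') \<in> fraction R a b" for a' b'
    by (rule UN_constant_eq[OF cd]) (use that eq in \<open>simp add: case_prod_beta\<close>)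
  then show ?thesis
    by (intro UN_constant_eq[OF ab]) (simp add: case_prod_beta)
qed

lemma mult_fraction:
  assumes "a \<in> carrier R" "b \<in> carrier R - {\<zero>}" "c \<in> carrier R" "d \<in> carrier R - {\<zero>}"
  shows "fraction R a b \<otimes>\<^bsub>quotient_field R\<^esub> fraction R c d = fraction R (a \<otimes> c) (b \<otimes> d)"
proof -
  have "(\<Union>(a, b)\<in>fraction R a b. \<Union>(c, d)\<in>fraction R c d. fraction R (a \<otimes> c) (b \<otimes> d)) =
    fraction R (a \<otimes> c) (b \<otimes> d)"
  proof (rule fraction_binop[OF assms])
    fix a b c d a' b' c' d'
    assume *: "((a, b), (a', b')) \<in> fraction_rel R" "((c, d), (c', d')) \<in> fraction_rel R"
    then have mem: "a \<in> carrier R" "b \<in> carrier R" "c \<in> carrier R" "d \<in> carrier R"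
        "a' \<in> carrier R" "b' \<in> carrier R" "c' \<in> carrier R" "d' \<in> carrier R"
        "b \<noteq> \<zero>" "b' \<noteq> \<zero>" "d \<noteq> \<zero>" "d' \<noteq> \<zero>"
      and e: "a \<otimes> b' = a' \<otimes> b" "c \<otimes> d' = c' \<otimes> d"
      by (auto simp: fraction_rel_def)
    have "(a \<otimes> c) \<otimes> (b' \<otimes> d') = (a \<otimes> b') \<otimes> (c \<otimes> d')" using mem by (simp add: m_ac)
    also have "\<dots> = (a' \<otimes> c') \<otimes> (b \<otimes> d)" using mem by (simp add: e m_ac)
    finally show "fraction R (a \<otimes> c) (b \<otimes> d) = fraction R (a' \<otimes> c') (b' \<otimes> d')"
      using mem by (subst fraction_eq_iff) (auto simp: integral_iff)
  qed
  then show ?thesis by (simp add: quotient_field_def)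
qed

lemma add_fraction:
  assumes "a \<in> carrier R" "b \<in> carrier R - {\<zero>}" "c \<in> carrier R" "d \<in> carrier R - {\<zero>}"
  shows "fraction R a b \<oplus>\<^bsub>quotient_field R\<^esub> fraction R c d = fraction R (a \<otimes> d \<oplus> c \<otimes> b) (b \<otimes> d)"
proof -
  have "(\<Union>(a, b)\<in>fraction R a b. \<Union>(c, d)\<in>fraction R c d. fraction R (a \<otimes> d \<oplus> c \<otimes> b) (b \<otimes> d)) =
    fraction R (a \<otimes> d \<oplus> c \<otimes> b) (b \<otimes> d)"
  proof (rule fraction_binop[OF assms])
    fix a b c d a' b' c' d'
    assume *: "((a, b), (a', b')) \<in> fraction_rel R" "((c, d), (c', d')) \<in> fraction_rel R"
    then have mem: "a \<in> carrier R" "b \<in> carrier R" "c \<in> carrier R" "d \<in> carrier R"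
        "a' \<in> carrier R" "b' \<in> carrier R" "c' \<in> carrier R" "d' \<in> carrier R"
        "b \<noteq> \<zero>" "b' \<noteq> \<zero>" "d \<noteq> \<zero>" "d' \<noteq> \<zero>"
      and e: "a \<otimes> b' = a' \<otimes> b" "c \<otimes> d' = c' \<otimes> d"
      by (auto simp: fraction_rel_def)
    have "(a \<otimes> d \<oplus> c \<otimes> b) \<otimes> (b' \<otimes> d') = (a \<otimes> b') \<otimes> (d \<otimes> d') \<oplus> (c \<otimes> d') \<otimes> (b \<otimes> b')"
      if "a \<in> carrier R" "c \<in> carrier R" "b \<in> carrier R" "d \<in> carrier R"
        "b' \<in> carrier R" "d' \<in> carrier R" for a b c d b' d'
    proof -
      have "(a \<otimes> d) \<otimes> (b' \<otimes> d') = (a \<otimes> b') \<otimes> (d \<otimes> d')" "(c \<otimes> b) \<otimes> (b' \<otimes> d') = (c \<otimes> d') \<otimes> (b \<otimes> b')"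
        using that by (simp_all add: m_ac)
      then show ?thesis using that by (simp add: l_distr)
    qed
    note expand = this
    have "(a \<otimes> d \<oplus> c \<otimes> b) \<otimes> (b' \<otimes> d') = (a' \<otimes> b) \<otimes> (d \<otimes> d') \<oplus> (c' \<otimes> d) \<otimes> (b \<otimes> b')"
      using mem by (simp only: expand e)
    also have "\<dots> = (a' \<otimes> b) \<otimes> (d' \<otimes> d) \<oplus> (c' \<otimes> d) \<otimes> (b' \<otimes> b)"
      using mem by (simp only: m_comm)
    also have "\<dots> = (a' \<otimes> d' \<oplus> c' \<otimes> b') \<otimes> (b \<otimes> d)"
      using mem expand[of a' c' b' d' b d] by simp
    finally show "fraction R (a \<otimes> d \<oplus> c \<otimes> b) (b \<otimes> d) = fraction R (a' \<otimes> d' \<oplus> c' \<otimes> b') (b' \<otimes> d')"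
      using mem by (subst fraction_eq_iff) (auto simp: integral_iff)
  qed
  then show ?thesis by (simp add: quotient_field_def)
qed

lemma fraction_in_carrier:
  "a \<in> carrier R \<Longrightarrow> b \<in> carrier R - {\<zero>} \<Longrightarrow> fraction R a b \<in> carrier (quotient_field R)"
  by (auto simp: quotient_field_def)

lemma quotient_field_cases:
  assumes "u \<in> carrier (quotient_field R)"
  obtains a b where "u = fraction R a b" "a \<in> carrier R" "b \<in> carrier R" "b \<noteq> \<zero>"
  using assms by (auto simp: quotient_field_def)

lemma field_quotient_field: "field (quotient_field R)"
proof -
  let ?Q = "quotient_field R"
  have zero: "\<zero>\<^bsub>?Q\<^esub> = fraction R \<zero> \<one>" and one: "\<one>\<^bsub>?Q\<^esub> = fraction R \<one> \<one>"
    by (simp_all add: quotient_field_def)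
  note ops = mult_fraction add_fraction zero one fraction_in_carrier
    fraction_eq_iff integral_iff l_distr r_distr
  have "cring ?Q"
  proof (rule cringI)
    show "abelian_group ?Q"
    proof (rule abelian_groupI)
      fix u assume "u \<in> carrier ?Q"
      then obtain a b where u: "u = fraction R a b" "a \<in> carrier R" "b \<in> carrier R" "b \<noteq> \<zero>"
        by (rule quotient_field_cases)
      have "fraction R (\<ominus> a) b \<oplus>\<^bsub>?Q\<^esub> u = \<zero>\<^bsub>?Q\<^esub>"
        using u by (simp add: ops l_minus l_neg)
      then show "\<exists>v\<in>carrier ?Q. v \<oplus>\<^bsub>?Q\<^esub> u = \<zero>\<^bsub>?Q\<^esub>"
        using u fraction_in_carrier[of "\<ominus> a" b] by auto
    qed (auto elim!: quotient_field_cases simp: ops m_ac a_ac)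
    show "comm_monoid ?Q"
      by (rule comm_monoidI) (auto elim!: quotient_field_cases simp: ops m_ac)
  next
    fix u v w assume "u \<in> carrier ?Q" "v \<in> carrier ?Q" "w \<in> carrier ?Q"
    then obtain a b c d e f where u: "u = fraction R a b" "v = fraction R c d" "w = fraction R e f"
      and mem: "a \<in> carrier R" "b \<in> carrier R" "c \<in> carrier R" "d \<in> carrier R"
        "e \<in> carrier R" "f \<in> carrier R" "b \<noteq> \<zero>" "d \<noteq> \<zero>" "f \<noteq> \<zero>"
      by (elim quotient_field_cases)
    show "(u \<oplus>\<^bsub>?Q\<^esub> v) \<otimes>\<^bsub>?Q\<^esub> w = u \<otimes>\<^bsub>?Q\<^esub> w \<oplus>\<^bsub>?Q\<^esub> v \<otimes>\<^bsub>?Q\<^esub> w"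
    proof -
      define x where "x = a \<otimes> d \<oplus> c \<otimes> b"
      have x: "x \<in> carrier R" using mem by (simp add: x_def)
      have "(a \<otimes> e) \<otimes> (d \<otimes> f) \<oplus> (c \<otimes> e) \<otimes> (b \<otimes> f) = (a \<otimes> d) \<otimes> (e \<otimes> f) \<oplus> (c \<otimes> b) \<otimes> (e \<otimes> f)"
        using mem by (simp add: m_ac)
      then have sum: "(a \<otimes> e) \<otimes> (d \<otimes> f) \<oplus> (c \<otimes> e) \<otimes> (b \<otimes> f) = x \<otimes> (e \<otimes> f)"
        using mem by (simp add: x_def l_distr)
      have "fraction R (x \<otimes> e) ((b \<otimes> d) \<otimes> f) = fraction R (x \<otimes> (e \<otimes> f)) ((b \<otimes> f) \<otimes> (d \<otimes> f))"
        using mem x by (subst fraction_eq_iff) (simp_all add: integral_iff m_ac)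
      then show ?thesis
        using mem x unfolding u
        by (simp add: mult_fraction add_fraction integral_iff sum flip: x_def)
    qed
  qed
  then interpret Q: cring ?Q .
  show ?thesis
  proof (rule Q.cring_fieldI2)
    show "\<zero>\<^bsub>?Q\<^esub> \<noteq> \<one>\<^bsub>?Q\<^esub>" by (simp add: ops)
  next
    fix u assume "u \<in> carrier ?Q" "u \<noteq> \<zero>\<^bsub>?Q\<^esub>"
    then obtain a b where u: "u = fraction R a b" "a \<in> carrier R" "b \<in> carrier R" "b \<noteq> \<zero>"
      using quotient_field_cases by blast
    with \<open>u \<noteq> \<zero>\<^bsub>?Q\<^esub>\<close> have "a \<noteq> \<zero>" by (auto simp: ops)
    with u have "u \<otimes>\<^bsub>?Q\<^esub> fraction R b a = \<one>\<^bsub>?Q\<^esub>" by (simp add: ops m_ac)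
    with u \<open>a \<noteq> \<zero>\<close> show "\<exists>v\<in>carrier ?Q. u \<otimes>\<^bsub>?Q\<^esub> v = \<one>\<^bsub>?Q\<^esub>"
      using fraction_in_carrier[of b a] by auto
  qed
qed

end


section \<open>Transcendence degree\<close>

text \<open>The base field is given as the image of a type \<open>'k\<close> of scalars under an
  embedding \<open>\<phi>\<close> into the ambient field \<open>L\<close>.\<close>

definition mpoly_eval ::
    "('l, 'm) ring_scheme \<Rightarrow> ('k::comm_ring_1 \<Rightarrow> 'l) \<Rightarrow> (('l \<Rightarrow>\<^sub>0 nat) \<Rightarrow>\<^sub>0 'k) \<Rightarrow> 'l"
  where "mpoly_eval L \<phi> p =
    (\<Oplus>\<^bsub>L\<^esub>m \<in> Poly_Mapping.keys p. \<phi> (Poly_Mapping.lookup p m) \<otimes>\<^bsub>L\<^esub>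
      (\<Otimes>\<^bsub>L\<^esub>b \<in> Poly_Mapping.keys m. b [^]\<^bsub>L\<^esub> Poly_Mapping.lookup m b))"

definition algebraically_independent ::
    "('l, 'm) ring_scheme \<Rightarrow> ('k::comm_ring_1 \<Rightarrow> 'l) \<Rightarrow> 'l set \<Rightarrow> bool"
  where "algebraically_independent L \<phi> B \<longleftrightarrow> B \<subseteq> carrier L \<and>
    (\<forall>p. (\<forall>m\<in>Poly_Mapping.keys p. Poly_Mapping.keys m \<subseteq> B) \<and>
       mpoly_eval L \<phi> p = \<zero>\<^bsub>L\<^esub> \<longrightarrow> p = 0)"

definition transcendence_basis ::
    "('l, 'm) ring_scheme \<Rightarrow> ('k::comm_ring_1 \<Rightarrow> 'l) \<Rightarrow> 'l set \<Rightarrow> 'l set \<Rightarrow> bool"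
  where "transcendence_basis L \<phi> E B \<longleftrightarrow> B \<subseteq> E \<and> algebraically_independent L \<phi> B \<and>
    (\<forall>x\<in>E. ring.algebraic L (generate_field L (range \<phi> \<union> B)) x)"

text \<open>A relation rather than a function; all transcendence bases have the same cardinality.\<close>

definition has_tr_deg ::
    "('l, 'm) ring_scheme \<Rightarrow> ('k::comm_ring_1 \<Rightarrow> 'l) \<Rightarrow> 'l set \<Rightarrow> nat \<Rightarrow> bool"
  where "has_tr_deg L \<phi> E d \<longleftrightarrow> (\<exists>B. transcendence_basis L \<phi> E B \<and> finite B \<and> card B = d)"


section \<open>Inversive difference fields with two translations\<close>

definition field_automorphism :: "('k::field \<Rightarrow> 'k) \<Rightarrow> bool"
  where "field_automorphism f \<longleftrightarrow> bij f \<and> f 1 = 1 \<and>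
    (\<forall>x y. f (x + y) = f x + f y) \<and> (\<forall>x y. f (x * y) = f x * f y)"

definition inversive_difference_field :: "('k::field_char_0 \<Rightarrow> 'k) \<Rightarrow> ('k \<Rightarrow> 'k) \<Rightarrow> bool"
  where "inversive_difference_field \<alpha>1 \<alpha>2 \<longleftrightarrow>
    field_automorphism \<alpha>1 \<and> field_automorphism \<alpha>2 \<and> \<alpha>1 \<circ> \<alpha>2 = \<alpha>2 \<circ> \<alpha>1"

definition is_constant :: "('k \<Rightarrow> 'k) \<Rightarrow> ('k \<Rightarrow> 'k) \<Rightarrow> 'k \<Rightarrow> bool"
  where "is_constant \<alpha>1 \<alpha>2 a \<longleftrightarrow> \<alpha>1 a = a \<and> \<alpha>2 a = a"

text \<open>Representation of the elements of the field as functions \<open>f(x, t)\<close> on which the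
  translations act by shifting the arguments. Nothing is required of the value type, so that
  functions with poles (\<open>'v option\<close>, or a conventional value at a pole) are covered. No field is
  excluded either: \<open>val f k l = \<alpha>1\<^sup>k \<alpha>2\<^sup>l f\<close> with integers \<open>k\<close>, \<open>l\<close> always qualifies.\<close>

definition elements_are_functions ::
    "('k \<Rightarrow> 'k) \<Rightarrow> ('k \<Rightarrow> 'k) \<Rightarrow> ('k \<Rightarrow> 'x::comm_ring_1 \<Rightarrow> 'x \<Rightarrow> 'v) \<Rightarrow> bool"
  where "elements_are_functions \<alpha>1 \<alpha>2 val \<longleftrightarrow> inj val \<and>
    (\<forall>f x t. val (\<alpha>1 f) x t = val f (x + 1) t) \<and> (\<forall>f x t. val (\<alpha>2 f) x t = val f x (t + 1))"

text \<open>The free commutative group \<open>\<Gamma>\<close>, written additively: the pair \<open>(k1, k2)\<close> is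
  \<open>\<alpha>1\<^sup>k1 \<alpha>2\<^sup>k2\<close>.\<close>

type_synonym gam = "int \<times> int"

definition gam_ord :: "gam \<Rightarrow> int"
  where "gam_ord \<gamma> = \<bar>fst \<gamma>\<bar> + \<bar>snd \<gamma>\<bar>"

definition Gam :: "nat \<Rightarrow> gam set"
  where "Gam r = {\<gamma>. gam_ord \<gamma> \<le> int r}"

definition int_iterate :: "('k \<Rightarrow> 'k) \<Rightarrow> int \<Rightarrow> 'k \<Rightarrow> 'k"
  where "int_iterate f k = (if 0 \<le> k then f ^^ nat k else (inv_into UNIV f) ^^ nat (- k))"

definition gam_act :: "('k \<Rightarrow> 'k) \<Rightarrow> ('k \<Rightarrow> 'k) \<Rightarrow> gam \<Rightarrow> 'k \<Rightarrow> 'k"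
  where "gam_act \<alpha>1 \<alpha>2 \<gamma> = int_iterate \<alpha>1 (fst \<gamma>) \<circ> int_iterate \<alpha>2 (snd \<gamma>)"


section \<open>Inversive difference polynomials\<close>

text \<open>The variable \<open>(\<gamma>, i)\<close> is the indeterminate \<open>\<gamma> y\<^sub>i\<close>; the type \<open>'i\<close> indexes
  \<open>y\<^sub>1, \<dots>, y\<^sub>n\<close>, and a monomial is its finitely supported exponent function.\<close>

type_synonym ('i, 'k) spoly = "((gam \<times> 'i) \<Rightarrow>\<^sub>0 nat) \<Rightarrow>\<^sub>0 'k"

definition coef :: "'k::comm_ring_1 \<Rightarrow> ('i, 'k) spoly"
  where "coef c = Poly_Mapping.single 0 c"

definition ind :: "gam \<Rightarrow> 'i \<Rightarrow> ('i, 'k::comm_ring_1) spoly"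
  where "ind \<gamma> i = Poly_Mapping.single (Poly_Mapping.single (\<gamma>, i) 1) 1"

definition spoly_act ::
    "('k::comm_ring_1 \<Rightarrow> 'k) \<Rightarrow> ('k \<Rightarrow> 'k) \<Rightarrow> gam \<Rightarrow> ('i, 'k) spoly \<Rightarrow> ('i, 'k) spoly"
  where "spoly_act \<alpha>1 \<alpha>2 \<gamma> p = (\<Sum>m\<in>Poly_Mapping.keys p.
    coef (gam_act \<alpha>1 \<alpha>2 \<gamma> (Poly_Mapping.lookup p m)) *
    (\<Prod>(\<delta>, i)\<in>Poly_Mapping.keys m. ind (\<gamma> + \<delta>) i ^ Poly_Mapping.lookup m (\<delta>, i)))"

definition spoly_ring :: "('i, 'k::comm_ring_1) spoly ring"
  where "spoly_ring = ring_of_type_algebra"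

definition sideal ::
    "('k::comm_ring_1 \<Rightarrow> 'k) \<Rightarrow> ('k \<Rightarrow> 'k) \<Rightarrow> ('i, 'k) spoly set \<Rightarrow> ('i, 'k) spoly set"
  where "sideal \<alpha>1 \<alpha>2 S = Idl\<^bsub>spoly_ring\<^esub> (\<Union>\<gamma>. spoly_act \<alpha>1 \<alpha>2 \<gamma> ` S)"

definition prime_system ::
    "('k::comm_ring_1 \<Rightarrow> 'k) \<Rightarrow> ('k \<Rightarrow> 'k) \<Rightarrow> ('i, 'k) spoly set \<Rightarrow> bool"
  where "prime_system \<alpha>1 \<alpha>2 S \<longleftrightarrow> primeideal (sideal \<alpha>1 \<alpha>2 S) spoly_ring"

definition quot_ring :: "('i, 'k::comm_ring_1) spoly set \<Rightarrow> ('i, 'k) spoly set ring"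
  where "quot_ring P = spoly_ring Quot P"

definition to_quotient_field ::
    "('i, 'k::comm_ring_1) spoly set \<Rightarrow> ('i, 'k) spoly \<Rightarrow>
     (('i, 'k) spoly set \<times> ('i, 'k) spoly set) set"
  where "to_quotient_field P f = fraction (quot_ring P) (P +>\<^bsub>spoly_ring\<^esub> f) \<one>\<^bsub>quot_ring P\<^esub>"

text \<open>The image of \<open>ind \<gamma> i\<close> in the quotient field is \<open>\<gamma> \<eta>\<^sub>i\<close>.\<close>

definition is_dimension_polynomial ::
    "('k::field_char_0 \<Rightarrow> 'k) \<Rightarrow> ('k \<Rightarrow> 'k) \<Rightarrow> ('i::finite, 'k) spoly set \<Rightarrow> rat poly \<Rightarrow> bool"
  where "is_dimension_polynomial \<alpha>1 \<alpha>2 S \<psi> \<longleftrightarrow> prime_system \<alpha>1 \<alpha>2 S \<and>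
    (let P = sideal \<alpha>1 \<alpha>2 S;
         L = quotient_field (quot_ring P);
         \<phi> = (\<lambda>c. to_quotient_field P (coef c))
     in \<forall>\<^sub>F r in sequentially. \<exists>d.
          has_tr_deg L \<phi>
            (generate_field L (range \<phi> \<union> {to_quotient_field P (ind \<gamma> i) | \<gamma> i. \<gamma> \<in> Gam r})) d \<and>
          poly \<psi> (of_nat r) = of_nat d)"


section \<open>Difference schemes for the reaction-diffusion equation\<close>

text \<open>One indeterminate \<open>y\<close>, i.e. index type \<open>unit\<close>; \<open>yy k l\<close> is \<open>\<alpha>1\<^sup>k \<alpha>2\<^sup>l y\<close>.\<close>

abbreviation yy :: "int \<Rightarrow> int \<Rightarrow> (unit, 'k::comm_ring_1) spoly"
  where "yy k l \<equiv> ind (k, l) ()"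

definition at_y :: "'k::comm_ring_1 poly \<Rightarrow> (unit, 'k) spoly"
  where "at_y F = poly (map_poly coef F) (yy 0 0)"

definition forward_scheme ::
    "'k::comm_ring_1 \<Rightarrow> 'k \<Rightarrow> 'k \<Rightarrow> 'k poly \<Rightarrow> (unit, 'k) spoly"
  where "forward_scheme a b c F =
    (let G = at_y F - coef a * (yy 0 0)^2 - coef (b + c - 1) * yy 0 0
     in yy 2 0 + (coef a * yy 0 0 + coef b - 2) * yy 1 0 + coef c * yy 0 1 + G)"

definition symmetric_scheme ::
    "'k::comm_ring_1 \<Rightarrow> 'k \<Rightarrow> 'k \<Rightarrow> 'k poly \<Rightarrow> (unit, 'k) spoly"
  where "symmetric_scheme a b c F =
    (coef a * yy 0 0 + coef b + 1) * yy 1 0 + (1 - coef a * yy 0 0 - coef b) * yy (-1) 0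
    + coef c * yy 0 1 - coef c * yy 0 (-1) + at_y F - 2 * yy 0 0"

end

theory Submission
  imports Defs "HOL-Library.Product_Lexorder"
begin

text \<open>Write \<open>y\<^sub>k\<^sub>l\<close> for \<open>\<alpha>1\<^sup>k \<alpha>2\<^sup>l y\<close>. The ideal of a scheme is generated by all its translates \<open>A\<^sub>\<gamma>\<close>, and
the translates are solved like an infinite triangular system: a map \<open>lead\<close> picks from every
\<open>A\<^sub>\<gamma>\<close> one of its indeterminates, injectively, and a rank function puts all other indeterminates of
\<open>A\<^sub>\<gamma>\<close> below the chosen one. The indeterminates which are not leads then parametrise the generic
solution. If moreover the lead of \<open>A\<^sub>\<gamma>\<close> is an indeterminate of maximal order in \<open>A\<^sub>\<gamma>\<close>, the same
description is valid inside each ball \<open>\<Gamma>(r)\<close>: the points of \<open>\<Gamma>(r)\<close> which are not leads index a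
transcendence basis, and the dimension polynomial counts them.

Every lead in the ball is algebraic over the points of smaller rank, because the derivative of
\<open>A\<^sub>\<gamma>\<close> with respect to its lead, the separant, does not vanish at the generic point
(\<open>algebraic_if_simple_root\<close>, \<open>has_tr_deg_nonleads\<close>). The non-leads are algebraically independent
modulo the ideal \<open>P\<close> because the linearised system can be solved with arbitrary values on
them: this requires only divisions by separants, and it shows that \<open>P\<close> contains with a
polynomial in the non-leads also its partial derivatives, down to a nonzero constant if there was
any nonzero polynomial to start with (\<open>tangent_vector\<close>, \<open>separable_triangular.free_nonleads\<close>). In
this way the equations which are nonlinear in their leads need no algebraically closed field.

That \<open>P\<close> is prime, and that the separants are not in \<open>P\<close>, follows from leads which occur linearly with
a nonzero constant of \<open>K\<close> as coefficient: finitely many such equations can be eliminated by a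
substitution, so modulo \<open>P\<close> one computes in a polynomial ring (\<open>unit_triangular.elimination\<close>).

In the symmetric scheme, \<open>A\<^sub>k\<^sub>l\<close> is solved for \<open>y\<^sub>k\<^sub>,\<^sub>l\<^sub>+\<^sub>1\<close> if \<open>l \<ge> 0\<close> and for \<open>y\<^sub>k\<^sub>,\<^sub>l\<^sub>-\<^sub>1\<close> if \<open>l < 0\<close>,
with the coefficients \<open>c\<close> and \<open>-c\<close>; the rows \<open>0\<close> and \<open>-1\<close> remain, which have \<open>4 r\<close> points in the ball.
In the forward scheme the maximal order is attained at \<open>y\<^sub>k\<^sub>+\<^sub>2\<^sub>,\<^sub>l\<close>, at \<open>y\<^sub>k\<^sub>,\<^sub>l\<^sub>+\<^sub>1\<close> or, in the
quadrant \<open>k \<le> -2\<close>, \<open>l < 0\<close>, only at \<open>y\<^sub>k\<^sub>l\<close> itself, in which \<open>A\<^sub>k\<^sub>l\<close> is nonlinear; its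
separant there is \<open>a y\<^sub>k\<^sub>+\<^sub>1\<^sub>,\<^sub>l\<close> plus a polynomial in \<open>y\<^sub>k\<^sub>l\<close>. It is not in \<open>P\<close> since \<open>a \<noteq> 0\<close> and
since the indeterminates of one row are independent modulo \<open>P\<close>, as a solution of the system
starting from that row with constant coefficients shows. There remain \<open>5 r\<close> points in the ball.\<close>

section \<open>Polynomials, substitution and occurring variables\<close>

definition mconst :: "'k::comm_ring_1 \<Rightarrow> ('v \<Rightarrow>\<^sub>0 nat) \<Rightarrow>\<^sub>0 'k"
  where "mconst c = Poly_Mapping.single 0 c"

definition mvar :: "'v \<Rightarrow> ('v \<Rightarrow>\<^sub>0 nat) \<Rightarrow>\<^sub>0 'k::comm_ring_1"
  where "mvar x = Poly_Mapping.single (Poly_Mapping.single x 1) 1"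

definition mvars :: "(('v \<Rightarrow>\<^sub>0 nat) \<Rightarrow>\<^sub>0 'k::zero) \<Rightarrow> 'v set"
  where "mvars p = (\<Union>m\<in>Poly_Mapping.keys p. Poly_Mapping.keys m)"

definition meval :: "('v \<Rightarrow> 'r::comm_ring_1) \<Rightarrow> ('v \<Rightarrow>\<^sub>0 nat) \<Rightarrow> 'r"
  where "meval u m = (\<Prod>x\<in>Poly_Mapping.keys m. u x ^ Poly_Mapping.lookup m x)"

definition msubst :: "('k::comm_ring_1 \<Rightarrow> 'r::comm_ring_1) \<Rightarrow> ('v \<Rightarrow> 'r) \<Rightarrow> (('v \<Rightarrow>\<^sub>0 nat) \<Rightarrow>\<^sub>0 'k) \<Rightarrow> 'r"
  where "msubst \<phi> u p = (\<Sum>m\<in>Poly_Mapping.keys p. \<phi> (Poly_Mapping.lookup p m) * meval u m)"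

lemma mconst_0 [simp]: "mconst 0 = 0" and mconst_1 [simp]: "mconst 1 = 1"
  and mconst_add: "mconst (a + b) = mconst a + mconst b"
  and mconst_mult: "mconst (a * b) = mconst a * mconst b"
  and mconst_uminus: "mconst (- a) = - mconst a"
  and mconst_diff: "mconst (a - b) = mconst a - mconst b"
  by (simp_all add: mconst_def single_add mult_single single_uminus single_diff)

lemma mconst_of_nat: "mconst (of_nat n) = of_nat n"
  by (simp add: mconst_def)

lemma mconst_eq_0_iff [simp]: "mconst c = 0 \<longleftrightarrow> c = 0"
  by (metis lookup_single_eq lookup_zero mconst_0 mconst_def)

lemma poly_mapping_eq_sum_single:
  "p = (\<Sum>m\<in>Poly_Mapping.keys p. Poly_Mapping.single m (Poly_Mapping.lookup p m))"
proof (rule poly_mapping_eqI)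
  fix k
  have "Poly_Mapping.lookup (\<Sum>m\<in>Poly_Mapping.keys p. Poly_Mapping.single m (Poly_Mapping.lookup p m)) k
     = (\<Sum>m\<in>Poly_Mapping.keys p. if m = k then Poly_Mapping.lookup p m else 0)"
    by (auto simp: lookup_sum lookup_single when_def intro!: sum.cong)
  then show "Poly_Mapping.lookup p k = Poly_Mapping.lookup
      (\<Sum>m\<in>Poly_Mapping.keys p. Poly_Mapping.single m (Poly_Mapping.lookup p m)) k"
    by (auto simp: in_keys_iff)
qed

lemma meval_superset:
  assumes "finite S" "Poly_Mapping.keys m \<subseteq> S"
  shows "meval u m = (\<Prod>x\<in>S. u x ^ Poly_Mapping.lookup m x)"
  unfolding meval_def
  by (rule prod.mono_neutral_left) (use assms in \<open>auto simp: in_keys_iff\<close>)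

lemma meval_0 [simp]: "meval u 0 = 1"
  by (simp add: meval_def)

lemma meval_single [simp]: "meval u (Poly_Mapping.single x n) = u x ^ n"
  by (simp add: meval_def)

lemma meval_add: "meval u (m + n) = meval u m * meval u n"
proof -
  let ?S = "Poly_Mapping.keys m \<union> Poly_Mapping.keys n"
  have "meval u (m + n) = (\<Prod>x\<in>?S. u x ^ Poly_Mapping.lookup (m + n) x)"
    by (rule meval_superset) (simp_all add: keys_add)
  also have "\<dots> = meval u m * meval u n"
    by (simp add: lookup_add power_add prod.distrib meval_superset[of ?S])
  finally show ?thesis .
qed

lemma single_eq_mconst_meval: "Poly_Mapping.single m c = mconst c * meval mvar m"
proof -
  have pow: "(mvar x :: ('a \<Rightarrow>\<^sub>0 nat) \<Rightarrow>\<^sub>0 'b) ^ n = Poly_Mapping.single (Poly_Mapping.single x n) 1" for x n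
    by (induction n) (simp_all add: mvar_def mult_single flip: single_add)
  have single_sum: "(\<Prod>x\<in>S. Poly_Mapping.single (f x) (1::'b)) = Poly_Mapping.single (\<Sum>x\<in>S. f x) 1"
    if "finite S" for S and f :: "'a \<Rightarrow> ('a \<Rightarrow>\<^sub>0 nat)"
    using that by (induction rule: finite_induct) (simp_all add: mult_single)
  have "meval mvar m = (\<Prod>x\<in>Poly_Mapping.keys m.
      Poly_Mapping.single (Poly_Mapping.single x (Poly_Mapping.lookup m x)) (1::'b))"
    by (simp add: meval_def pow)
  also have "\<dots> = Poly_Mapping.single
      (\<Sum>x\<in>Poly_Mapping.keys m. Poly_Mapping.single x (Poly_Mapping.lookup m x)) 1"
    by (rule single_sum) simp
  also have "\<dots> = Poly_Mapping.single m 1"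
    using poly_mapping_eq_sum_single[of m] by simp
  finally show ?thesis
    by (simp add: mconst_def mult_single)
qed

lemma mpoly_induct [consumes 1, case_names const var add mult]:
  fixes p :: "('v \<Rightarrow>\<^sub>0 nat) \<Rightarrow>\<^sub>0 'k::comm_ring_1"
  assumes "mvars p \<subseteq> V"
    and const: "\<And>c. P (mconst c)" and var: "\<And>x. x \<in> V \<Longrightarrow> P (mvar x)"
    and add: "\<And>p q. P p \<Longrightarrow> P q \<Longrightarrow> P (p + q)" and mult: "\<And>p q. P p \<Longrightarrow> P q \<Longrightarrow> P (p * q)"
  shows "P p"
proof -
  have P0: "P 0" and P1: "P 1"
    using const[of 0] const[of 1] by simp_all
  have pow: "P (p ^ n)" if "P p" for p n
    by (induction n) (use that P1 mult in auto)
  have prod: "P (\<Prod>x\<in>S. f x)" if "finite S" "\<And>x. x \<in> S \<Longrightarrow> P (f x)" for S and f :: "'v \<Rightarrow> _"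
    using that by (induction rule: finite_induct) (use P1 mult in auto)
  have sum: "P (\<Sum>x\<in>S. f x)" if "finite S" "\<And>x. x \<in> S \<Longrightarrow> P (f x)"
    for S and f :: "('v \<Rightarrow>\<^sub>0 nat) \<Rightarrow> _"
    using that by (induction rule: finite_induct) (use P0 add in auto)
  have "P (mconst c * meval mvar m)" if "m \<in> Poly_Mapping.keys p" for c m
    unfolding meval_def using that assms(1)
    by (intro mult const prod pow var) (auto simp: mvars_def)
  then have "P (\<Sum>m\<in>Poly_Mapping.keys p. Poly_Mapping.single m (Poly_Mapping.lookup p m))"
    by (intro sum) (simp_all add: single_eq_mconst_meval)
  then show ?thesis
    by (simp flip: poly_mapping_eq_sum_single)
qed

lemma mvars_0 [simp]: "mvars 0 = {}" and mvars_const [simp]: "mvars (mconst c) = {}"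
  by (auto simp: mvars_def mconst_def)

lemma mvars_var [simp]: "mvars (mvar x :: ('v \<Rightarrow>\<^sub>0 nat) \<Rightarrow>\<^sub>0 'k::comm_ring_1) = {x}"
  by (auto simp: mvars_def mvar_def)

lemma mvars_add: "mvars (p + q) \<subseteq> mvars p \<union> mvars q"
  using keys_add[of p q] by (auto simp: mvars_def)

lemma mvars_mult: "mvars (p * q) \<subseteq> mvars p \<union> mvars q"
  for p q :: "('v \<Rightarrow>\<^sub>0 nat) \<Rightarrow>\<^sub>0 'k::comm_ring_1"
proof
  fix x assume "x \<in> mvars (p * q)"
  then obtain m where m: "m \<in> Poly_Mapping.keys (p * q)" "x \<in> Poly_Mapping.keys m"
    by (auto simp: mvars_def)
  from m(1) keys_mult[of p q] obtain a b
    where "m = a + b" "a \<in> Poly_Mapping.keys p" "b \<in> Poly_Mapping.keys q" by blast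
  with m(2) keys_add[of a b] show "x \<in> mvars p \<union> mvars q"
    by (auto simp: mvars_def)
qed

lemma mvars_uminus [simp]: "mvars (- p) = mvars (p :: ('v \<Rightarrow>\<^sub>0 nat) \<Rightarrow>\<^sub>0 'k::comm_ring_1)"
  by (auto simp: mvars_def in_keys_iff)

lemma mvars_diff: "mvars (p - q) \<subseteq> mvars p \<union> mvars (q :: ('v \<Rightarrow>\<^sub>0 nat) \<Rightarrow>\<^sub>0 'k::comm_ring_1)"
  using mvars_add[of p "- q"] by simp

locale coeff_hom =
  fixes \<phi> :: "'k::comm_ring_1 \<Rightarrow> 'r::comm_ring_1"
  assumes hom_0 [simp]: "\<phi> 0 = 0" and hom_1 [simp]: "\<phi> 1 = 1"
    and hom_add: "\<phi> (a + b) = \<phi> a + \<phi> b" and hom_mult: "\<phi> (a * b) = \<phi> a * \<phi> b"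
begin

lemma msubst_superset:
  assumes "finite S" "Poly_Mapping.keys p \<subseteq> S"
  shows "msubst \<phi> u p = (\<Sum>m\<in>S. \<phi> (Poly_Mapping.lookup p m) * meval u m)"
  unfolding msubst_def
  by (rule sum.mono_neutral_left) (use assms in \<open>auto simp: in_keys_iff\<close>)

lemma msubst_single: "msubst \<phi> u (Poly_Mapping.single m c) = \<phi> c * meval u m"
  by (auto simp: msubst_def)

lemma msubst_const [simp]: "msubst \<phi> u (mconst c) = \<phi> c"
  by (simp add: mconst_def msubst_single)

lemma msubst_0 [simp]: "msubst \<phi> u 0 = 0" and msubst_1 [simp]: "msubst \<phi> u 1 = 1"
  using msubst_const[of u 0] msubst_const[of u 1] by simp_all

lemma msubst_var [simp]: "msubst \<phi> u (mvar x) = u x"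
  by (simp add: mvar_def msubst_single)

lemma msubst_add: "msubst \<phi> u (p + q) = msubst \<phi> u p + msubst \<phi> u q"
proof -
  let ?S = "Poly_Mapping.keys p \<union> Poly_Mapping.keys q"
  have "msubst \<phi> u (p + q) = (\<Sum>m\<in>?S. \<phi> (Poly_Mapping.lookup (p + q) m) * meval u m)"
    by (rule msubst_superset) (simp_all add: keys_add)
  also have "\<dots> = msubst \<phi> u p + msubst \<phi> u q"
    by (simp add: lookup_add hom_add distrib_right sum.distrib msubst_superset[of ?S])
  finally show ?thesis .
qed

lemma msubst_sum: "msubst \<phi> u (sum f S) = (\<Sum>x\<in>S. msubst \<phi> u (f x))"
  by (induction S rule: infinite_finite_induct) (simp_all add: msubst_add)

lemma msubst_mult: "msubst \<phi> u (p * q) = msubst \<phi> u p * msubst \<phi> u q"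
proof -
  let ?s = "\<lambda>p m. Poly_Mapping.single m (Poly_Mapping.lookup p m)"
  have "p * q = (\<Sum>m\<in>Poly_Mapping.keys p. ?s p m) * (\<Sum>n\<in>Poly_Mapping.keys q. ?s q n)"
    by (simp flip: poly_mapping_eq_sum_single)
  also have "\<dots> = (\<Sum>m\<in>Poly_Mapping.keys p. \<Sum>n\<in>Poly_Mapping.keys q. ?s p m * ?s q n)"
    by (rule sum_product)
  finally show ?thesis
    by (simp add: msubst_sum mult_single msubst_single hom_mult meval_add)
       (simp add: msubst_def sum_product mult_ac)
qed

lemma msubst_uminus: "msubst \<phi> u (- p) = - msubst \<phi> u p"
  using msubst_add[of u p "- p"] by (simp add: eq_neg_iff_add_eq_0 add.commute)

lemma msubst_diff: "msubst \<phi> u (p - q) = msubst \<phi> u p - msubst \<phi> u q"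
  using msubst_add[of u p "- q"] by (simp add: msubst_uminus)

lemma msubst_power: "msubst \<phi> u (p ^ n) = msubst \<phi> u p ^ n"
  by (induction n) (simp_all add: msubst_mult)

lemma msubst_of_nat: "msubst \<phi> u (of_nat n) = of_nat n"
  by (induction n) (simp_all add: msubst_add)

lemma msubst_numeral: "msubst \<phi> u (numeral n) = numeral n"
  using msubst_of_nat[of u "numeral n"] by simp

end

lemma msubst_cong: "(\<And>x. x \<in> mvars p \<Longrightarrow> u x = w x) \<Longrightarrow> msubst \<phi> u p = msubst \<phi> w p"
  unfolding msubst_def meval_def
  by (intro sum.cong arg_cong2[where f = "(*)"] prod.cong arg_cong2[where f = "(^)"])
    (auto simp: mvars_def)

global_interpretation mc: coeff_hom mconst
  by unfold_locales (simp_all add: mconst_add mconst_mult)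

lemma mvars_msubst:
  assumes "mvars p \<subseteq> V" "\<And>x. x \<in> V \<Longrightarrow> mvars (u x) \<subseteq> W"
  shows "mvars (msubst mconst u p) \<subseteq> W"
  using assms(1)
proof (induction p rule: mpoly_induct)
  case (add p q)
  then show ?case
    using mvars_add[of "msubst mconst u p" "msubst mconst u q"] by (auto simp: mc.msubst_add)
next
  case (mult p q)
  then show ?case
    using mvars_mult[of "msubst mconst u p" "msubst mconst u q"] by (auto simp: mc.msubst_mult)
qed (simp_all add: assms(2))

lemma msubst_mvar [simp]: "msubst mconst mvar p = p"
  by (rule mpoly_induct[of p UNIV]) (simp_all add: mc.msubst_add mc.msubst_mult)

section \<open>Derivations of polynomial rings\<close>

text \<open>The tangent derivation \<open>\<Sum>\<^sub>x v\<^sub>x \<partial>p/\<partial>x\<close> along the vector field \<open>v\<close>, read off as the coefficient of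
\<open>\<epsilon>\<close> in \<open>p(y + \<epsilon> v)\<close>. With this definition the product rule is multiplication of
polynomials in \<open>\<epsilon>\<close>, and no sum over the occurring variables has to be handled.\<close>

definition mderiv :: "('v \<Rightarrow> ('v \<Rightarrow>\<^sub>0 nat) \<Rightarrow>\<^sub>0 'k::comm_ring_1) \<Rightarrow> (('v \<Rightarrow>\<^sub>0 nat) \<Rightarrow>\<^sub>0 'k) \<Rightarrow> (('v \<Rightarrow>\<^sub>0 nat) \<Rightarrow>\<^sub>0 'k)"
  where "mderiv v p = coeff (msubst (\<lambda>c. [:mconst c:]) (\<lambda>x. [:mvar x, v x:]) p) 1"

abbreviation mpartial :: "'v \<Rightarrow> (('v \<Rightarrow>\<^sub>0 nat) \<Rightarrow>\<^sub>0 'k::comm_ring_1) \<Rightarrow> (('v \<Rightarrow>\<^sub>0 nat) \<Rightarrow>\<^sub>0 'k)"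
  where "mpartial x \<equiv> mderiv (\<lambda>y. if y = x then 1 else 0)"

global_interpretation mcp: coeff_hom "\<lambda>c. [:mconst c:]"
  by unfold_locales (simp_all add: mconst_add mconst_mult one_pCons)

lemma coeff_0_perturbed:
  "coeff (msubst (\<lambda>c. [:mconst c:]) (\<lambda>x. [:mvar x, v x:]) p) 0 = p"
  by (rule mpoly_induct[of p UNIV]) (simp_all add: mcp.msubst_add mcp.msubst_mult coeff_mult)

lemma mderiv_const [simp]: "mderiv v (mconst c) = 0"
  and mderiv_var [simp]: "mderiv v (mvar x) = v x"
  and mderiv_add: "mderiv v (p + q) = mderiv v p + mderiv v q"
  and mderiv_mult: "mderiv v (p * q) = p * mderiv v q + mderiv v p * q"
  by (simp_all add: mderiv_def mcp.msubst_add mcp.msubst_mult coeff_mult coeff_0_perturbed)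

lemma mderiv_0 [simp]: "mderiv v 0 = 0" and mderiv_1 [simp]: "mderiv v 1 = 0"
  using mderiv_const[of v 0] mderiv_const[of v 1] by simp_all

lemma mderiv_sum: "mderiv v (sum f S) = (\<Sum>x\<in>S. mderiv v (f x))"
  by (induction S rule: infinite_finite_induct) (simp_all add: mderiv_add)

lemma mderiv_power: "mderiv v (p ^ n) = of_nat n * p ^ (n - 1) * mderiv v p"
proof (induction n)
  case (Suc n)
  then show ?case by (cases n) (simp_all add: mderiv_mult algebra_simps)
qed simp

lemma mderiv_linear:
  "mderiv (\<lambda>x. s * v x + t * w x) p = s * mderiv v p + t * mderiv w p"
  by (rule mpoly_induct[of p UNIV]) (simp_all add: mderiv_add mderiv_mult algebra_simps)

lemma mderiv_cong:
  assumes "\<And>x. x \<in> mvars p \<Longrightarrow> v x = w x"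
  shows "mderiv v p = mderiv w p"
  by (rule mpoly_induct[of p "mvars p"]) (simp_all add: mderiv_add mderiv_mult assms)

lemma mderiv_eq_0:
  assumes "\<And>x. x \<in> mvars p \<Longrightarrow> v x = 0"
  shows "mderiv v p = 0"
  by (rule mpoly_induct[of p "mvars p"]) (simp_all add: mderiv_add mderiv_mult assms)

lemma mderiv_scale: "mderiv (\<lambda>x. s * v x) p = s * mderiv v p"
  using mderiv_linear[of s v 0 v p] by simp

lemma mpartial_single:
  "mpartial x (Poly_Mapping.single m c) =
    Poly_Mapping.single (m - Poly_Mapping.single x 1) (c * of_nat (Poly_Mapping.lookup m x))"
proof -
  define n where "n = Poly_Mapping.lookup m x"
  define k where "k = m - Poly_Mapping.single x n"
  have m: "m = k + Poly_Mapping.single x n"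
    by (rule poly_mapping_eqI) (simp add: k_def lookup_add lookup_minus lookup_single n_def when_def)
  have k: "x \<notin> Poly_Mapping.keys k"
    by (simp add: k_def in_keys_iff lookup_minus n_def)
  have pow: "(mvar x :: ('a \<Rightarrow>\<^sub>0 nat) \<Rightarrow>\<^sub>0 'b) ^ i = Poly_Mapping.single (Poly_Mapping.single x i) 1" for i
    by (induction i) (simp_all add: mvar_def mult_single flip: single_add)
  have "Poly_Mapping.single m c = Poly_Mapping.single k c * mvar x ^ n"
    by (simp add: pow mult_single m)
  also have "mpartial x \<dots> = Poly_Mapping.single k c * mpartial x (mvar x ^ n)"
  proof -
    have "mpartial x (Poly_Mapping.single k c) = 0"
      by (rule mderiv_eq_0) (use k in \<open>auto simp: mvars_def split: if_splits\<close>)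
    then show ?thesis by (simp add: mderiv_mult)
  qed
  also have "\<dots> = Poly_Mapping.single k c * (mconst (of_nat n) * Poly_Mapping.single (Poly_Mapping.single x (n - 1)) 1)"
    by (simp add: mderiv_power mconst_of_nat flip: pow)
  also have "\<dots> = Poly_Mapping.single (k + Poly_Mapping.single x (n - 1)) (c * of_nat n)"
    by (simp add: mconst_def mult_single del: single_of_nat)
  also have "\<dots> = Poly_Mapping.single (m - Poly_Mapping.single x 1) (c * of_nat n)"
  proof (cases n)
    case (Suc i)
    then have "m - Poly_Mapping.single x 1 = k + Poly_Mapping.single x (n - 1)"
      by (intro poly_mapping_eqI) (auto simp: m lookup_add lookup_minus lookup_single when_def)
    then show ?thesis by simp
  qed simp
  finally show ?thesis by (simp add: n_def)
qed

text \<open>The factor on the right is never zero in characteristic \<open>0\<close>. Hence a polynomial all of whose partial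
derivatives vanish is constant, and on this the descent in
\<open>separable_triangular.free_nonleads\<close> rests.\<close>

lemma lookup_mpartial:
  "Poly_Mapping.lookup (mpartial x p) k =
    of_nat (Suc (Poly_Mapping.lookup k x)) * Poly_Mapping.lookup p (k + Poly_Mapping.single x 1)"
proof -
  let ?x = "Poly_Mapping.single x 1"
  have split: "k + ?x = m \<longleftrightarrow> m - ?x = k" if "Poly_Mapping.lookup m x \<noteq> 0" for m
  proof
    assume "m - ?x = k"
    then show "k + ?x = m"
      using that by (intro poly_mapping_eqI) (auto simp: lookup_add lookup_minus lookup_single when_def)
  qed auto
  have "Poly_Mapping.lookup (mpartial x p) k = Poly_Mapping.lookup (mpartial x
      (\<Sum>m\<in>Poly_Mapping.keys p. Poly_Mapping.single m (Poly_Mapping.lookup p m))) k"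
    by (simp flip: poly_mapping_eq_sum_single)
  also have "\<dots> = (\<Sum>m\<in>Poly_Mapping.keys p.
      (Poly_Mapping.lookup p m * of_nat (Poly_Mapping.lookup m x)) when m - ?x = k)"
    by (simp add: mderiv_sum mpartial_single lookup_sum lookup_single)
  also have "\<dots> = (\<Sum>m\<in>Poly_Mapping.keys p.
      if k + ?x = m then Poly_Mapping.lookup p m * of_nat (Poly_Mapping.lookup m x) else 0)"
  proof (rule sum.cong[OF refl])
    fix m
    show "((Poly_Mapping.lookup p m * of_nat (Poly_Mapping.lookup m x)) when m - ?x = k) =
      (if k + ?x = m then Poly_Mapping.lookup p m * of_nat (Poly_Mapping.lookup m x) else 0)"
      using split[of m] by (cases "Poly_Mapping.lookup m x = 0") (auto simp: when_def)
  qed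
  also have "\<dots> = Poly_Mapping.lookup p (k + ?x) * of_nat (Poly_Mapping.lookup (k + ?x) x)"
    by (auto simp: in_keys_iff)
  also have "Poly_Mapping.lookup (k + ?x) x = Suc (Poly_Mapping.lookup k x)"
    by (simp add: lookup_add)
  finally show ?thesis by (simp add: mult.commute)
qed

section \<open>Triangular systems of equations\<close>

definition lincombs :: "('g \<Rightarrow> 'a::comm_ring_1) \<Rightarrow> 'a set"
  where "lincombs A = {p. \<exists>T f. finite T \<and> p = (\<Sum>g\<in>T. f g * A g)}"

lemma lincombsI: "finite T \<Longrightarrow> p = (\<Sum>g\<in>T. f g * A g) \<Longrightarrow> p \<in> lincombs A"
  by (auto simp: lincombs_def)

lemma lincombs_gen: "A g \<in> lincombs A"
  by (rule lincombsI[of "{g}" _ "\<lambda>_. 1"]) simp_all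

lemma lincombs_0: "0 \<in> lincombs A"
  by (rule lincombsI[of "{}"]) simp_all

lemma lincombs_add:
  assumes "p \<in> lincombs A" "q \<in> lincombs A" shows "p + q \<in> lincombs A"
proof -
  obtain S f where S: "finite S" "p = (\<Sum>g\<in>S. f g * A g)"
    using assms(1) by (auto simp: lincombs_def)
  obtain T h where T: "finite T" "q = (\<Sum>g\<in>T. h g * A g)"
    using assms(2) by (auto simp: lincombs_def)
  let ?f = "\<lambda>g. if g \<in> S then f g else 0" and ?h = "\<lambda>g. if g \<in> T then h g else 0"
  have "(\<Sum>g\<in>S. f g * A g) = (\<Sum>g\<in>S \<union> T. ?f g * A g)"
    by (rule sum.mono_neutral_cong_left) (use S(1) T(1) in auto)
  moreover have "(\<Sum>g\<in>T. h g * A g) = (\<Sum>g\<in>S \<union> T. ?h g * A g)"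
    by (rule sum.mono_neutral_cong_left) (use S(1) T(1) in auto)
  ultimately have "p + q = (\<Sum>g\<in>S \<union> T. (?f g + ?h g) * A g)"
    unfolding S(2) T(2) by (simp only: sum.distrib distrib_right)
  then show ?thesis
    using S(1) T(1) by (intro lincombsI[of "S \<union> T"]) auto
qed

lemma lincombs_mult:
  assumes "p \<in> lincombs A" shows "q * p \<in> lincombs A"
proof -
  obtain S f where "finite S" "p = (\<Sum>g\<in>S. f g * A g)"
    using assms by (auto simp: lincombs_def)
  then show ?thesis
    by (intro lincombsI[of S _ "\<lambda>g. q * f g"]) (simp_all add: sum_distrib_left mult.assoc)
qed

lemma lincombs_mult_right: "p \<in> lincombs A \<Longrightarrow> p * q \<in> lincombs A"
  using lincombs_mult[of p A q] by (simp add: mult.commute)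

lemma lincombs_uminus: "p \<in> lincombs A \<Longrightarrow> - p \<in> lincombs A"
  using lincombs_mult[of p A "- 1"] by simp

lemma lincombs_diff: "p \<in> lincombs A \<Longrightarrow> q \<in> lincombs A \<Longrightarrow> p - q \<in> lincombs A"
  using lincombs_add[of p A "- q"] by (simp add: lincombs_uminus)

lemma lincombs_diff_msubst:
  assumes "\<And>x. mvar x - u x \<in> lincombs A"
  shows "p - msubst mconst u p \<in> lincombs A"
proof (rule mpoly_induct[of p UNIV])
  fix p q assume pq: "p - msubst mconst u p \<in> lincombs A" "q - msubst mconst u q \<in> lincombs A"
  have "p * (q - msubst mconst u q) + (p - msubst mconst u p) * msubst mconst u q \<in> lincombs A"
    by (intro lincombs_add lincombs_mult lincombs_mult_right pq)
  moreover have "(p - msubst mconst u p) + (q - msubst mconst u q) \<in> lincombs A"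
    by (intro lincombs_add pq)
  ultimately show "p * q - msubst mconst u (p * q) \<in> lincombs A"
      "p + q - msubst mconst u (p + q) \<in> lincombs A"
    by (simp_all add: mc.msubst_mult mc.msubst_add algebra_simps)
qed (simp_all add: assms lincombs_0)

text \<open>The values of \<open>rank\<close> may descend forever: an element of the generated ideal involves only finitely
many equations, and these can be sorted by the ranks of their leads. The linear order on the
variables serves to make the polynomial ring an integral domain.\<close>

locale triangular =
  fixes A :: "'g \<Rightarrow> ('v::linorder \<Rightarrow>\<^sub>0 nat) \<Rightarrow>\<^sub>0 'k::field_char_0"
    and lead :: "'g \<Rightarrow> 'v" and rank :: "'v \<Rightarrow> 'o::linorder"
  assumes inj_lead: "inj lead"
    and rank_less: "x \<in> mvars (A g) \<Longrightarrow> x \<noteq> lead g \<Longrightarrow> rank x < rank (lead g)"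
begin

text \<open>Equations with smaller leads are untouched when the value of a lead is changed. Both the elimination
and the linearised system are therefore treated by adding equations in the order of their leads.\<close>

lemma lead_not_in_earlier:
  assumes "rank (lead h) \<le> rank (lead g)" "g \<noteq> h"
  shows "lead g \<notin> mvars (A h)"
  using rank_less[of "lead g" h] assms inj_lead by (fastforce dest: injD)

end

locale unit_triangular = triangular A lead rank
  for A :: "'g \<Rightarrow> ('v::linorder \<Rightarrow>\<^sub>0 nat) \<Rightarrow>\<^sub>0 'k::field_char_0"
    and lead :: "'g \<Rightarrow> 'v" and rank :: "'v \<Rightarrow> 'o::linorder" +
  fixes e :: "'g \<Rightarrow> 'k" and B :: "'g \<Rightarrow> ('v \<Rightarrow>\<^sub>0 nat) \<Rightarrow>\<^sub>0 'k"
  assumes solved: "A g = mconst (e g) * mvar (lead g) + B g" and e_nonzero: "e g \<noteq> 0"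
    and lead_not_in_B: "lead g \<notin> mvars (B g)"
begin

text \<open>The equations are solved for their leads one after the other. The equation added last has the highest
lead, which does not occur in the earlier ones, so it may be redefined without spoiling them.\<close>

lemma elimination:
  assumes "finite T"
  obtains u where "\<And>g. g \<in> T \<Longrightarrow> msubst mconst u (A g) = 0"
    "\<And>x. mvar x - u x \<in> lincombs A" "\<And>x. x \<notin> range lead \<Longrightarrow> u x = mvar x"
proof -
  have "\<exists>u. (\<forall>g\<in>T. msubst mconst u (A g) = 0) \<and> (\<forall>x. mvar x - u x \<in> lincombs A) \<and>
    (\<forall>x. x \<notin> range lead \<longrightarrow> u x = mvar x)"
    using assms
  proof (induction T rule: finite_ranking_induct[where f = "\<lambda>g. rank (lead g)"])
    case empty
    show ?case by (rule exI[of _ mvar]) (simp add: lincombs_0)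
  next
    case (insert g T)
    then obtain u where u: "\<And>h. h \<in> T \<Longrightarrow> msubst mconst u (A h) = 0"
        "\<And>x. mvar x - u x \<in> lincombs A" "\<And>x. x \<notin> range lead \<Longrightarrow> u x = mvar x"
      by auto
    have reduce: "p - msubst mconst u p \<in> lincombs A" for p
      using u(2) by (rule lincombs_diff_msubst)
    show ?case
    proof (cases "g \<in> T")
      case True
      with u show ?thesis by (auto simp: insert_absorb)
    next
      case False
      \<comment> \<open>The new equation solved for its lead, all else kept\<close>
      define w where "w = u(lead g := - mconst (1 / e g) * msubst mconst u (B g))"
      have inv: "mconst (e g) * mconst (1 / e g) = 1" "mconst (1 / e g) * mconst (e g) = 1"
        using e_nonzero[of g] by (simp_all flip: mconst_mult)
      have "msubst mconst w (B g) = msubst mconst u (B g)"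
        by (rule msubst_cong) (use lead_not_in_B[of g] in \<open>auto simp: w_def\<close>)
      then have "msubst mconst w (A g) = mconst (e g) * w (lead g) + msubst mconst u (B g)"
        by (simp add: solved mc.msubst_add mc.msubst_mult)
      also have "\<dots> = 0"
        by (simp add: w_def inv mult.assoc[symmetric])
      finally have "msubst mconst w (A g) = 0" .
      moreover have "msubst mconst w (A h) = 0" if "h \<in> T" for h
      proof -
        have "lead g \<notin> mvars (A h)"
          using insert that False by (intro lead_not_in_earlier) auto
        then have "msubst mconst w (A h) = msubst mconst u (A h)"
          by (intro msubst_cong) (auto simp: w_def)
        then show ?thesis using u(1) that by simp
      qed
      moreover have "mvar x - w x \<in> lincombs A" for x
      proof (cases "x = lead g")
        case True
        have "mconst (1 / e g) * (A g - (B g - msubst mconst u (B g))) \<in> lincombs A"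
          by (intro lincombs_mult lincombs_diff lincombs_gen reduce)
        also have "mconst (1 / e g) * (A g - (B g - msubst mconst u (B g))) = mvar x - w x"
          by (simp add: solved w_def True algebra_simps) (simp add: inv mult.assoc[symmetric])
        finally show ?thesis .
      qed (simp add: w_def u(2))
      moreover have "w x = mvar x" if "x \<notin> range lead" for x
        using that u(3) by (auto simp: w_def)
      ultimately show ?thesis by blast
    qed
  qed
  then show ?thesis using that by blast
qed

lemma lincombs_eliminated:
  assumes "p \<in> lincombs A"
  obtains u where "msubst mconst u p = 0" "\<And>q. q - msubst mconst u q \<in> lincombs A"
    "\<And>x. x \<notin> range lead \<Longrightarrow> u x = mvar x"
proof -
  obtain T f where T: "finite T" "p = (\<Sum>g\<in>T. f g * A g)"
    using assms by (auto simp: lincombs_def)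
  obtain u where u: "\<And>g. g \<in> T \<Longrightarrow> msubst mconst u (A g) = 0"
    "\<And>x. mvar x - u x \<in> lincombs A" "\<And>x. x \<notin> range lead \<Longrightarrow> u x = mvar x"
    using elimination[OF T(1)] by blast
  have "q - msubst mconst u q \<in> lincombs A" for q
    using u(2) by (rule lincombs_diff_msubst)
  moreover have "msubst mconst u p = 0"
    by (simp add: T(2) mc.msubst_sum mc.msubst_mult u(1))
  ultimately show ?thesis using u(3) that by blast
qed

text \<open>If the substitution annihilates a product, it annihilates one factor, and this factor is congruent to
its image \<open>0\<close>. In effect the quotient is a direct limit of polynomial rings.\<close>

lemma lincombs_prime:
  assumes "p * q \<in> lincombs A" shows "p \<in> lincombs A \<or> q \<in> lincombs A"
proof -
  obtain u where u: "msubst mconst u (p * q) = 0" "\<And>q. q - msubst mconst u q \<in> lincombs A"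
    "\<And>x. x \<notin> range lead \<Longrightarrow> u x = mvar x"
    using lincombs_eliminated[OF assms] by blast
  from u(1) have "msubst mconst u p = 0 \<or> msubst mconst u q = 0"
    by (simp add: mc.msubst_mult)
  then show ?thesis using u(2)[of p] u(2)[of q] by auto
qed

lemma free_nonleads:
  assumes "p \<in> lincombs A" "mvars p \<inter> range lead = {}" shows "p = 0"
proof -
  obtain u where u: "msubst mconst u p = 0" "\<And>q. q - msubst mconst u q \<in> lincombs A"
    "\<And>x. x \<notin> range lead \<Longrightarrow> u x = mvar x"
    using lincombs_eliminated[OF assms(1)] by blast
  have "msubst mconst u p = msubst mconst mvar p"
    by (rule msubst_cong) (use assms(2) u(3) in auto)
  then show ?thesis using u(1) by simp
qed

lemma const_not_in_lincombs: "c \<noteq> 0 \<Longrightarrow> mconst c \<notin> lincombs A"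
  using free_nonleads[of "mconst c"] by auto

end

text \<open>Here the leads may occur nonlinearly. The last assumption says that each separant is nonzero
at the generic point.\<close>

locale separable_triangular = triangular A lead rank
  for A :: "'g \<Rightarrow> ('v::linorder \<Rightarrow>\<^sub>0 nat) \<Rightarrow>\<^sub>0 'k::field_char_0"
    and lead :: "'g \<Rightarrow> 'v" and rank :: "'v \<Rightarrow> 'o::linorder" +
  assumes prime: "\<And>p q. p * q \<in> lincombs A \<Longrightarrow> p \<in> lincombs A \<or> q \<in> lincombs A"
    and proper: "1 \<notin> lincombs A"
    and separant: "mpartial (lead g) (A g) \<notin> lincombs A"
begin

text \<open>A solution of the linearised equations which vanishes in all non-leads except \<open>b\<close>. Solving a linearised
equation for its lead means division by the separant; the denominators are
cleared at once, so that all values stay in the polynomial ring and the value in \<open>b\<close> is a product of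
separants instead of \<open>1\<close>.\<close>

lemma tangent_vector:
  assumes "finite T" "b \<notin> range lead"
  shows "\<exists>v. v b \<notin> lincombs A \<and> (\<forall>x. x \<notin> lead ` T \<longrightarrow> x \<noteq> b \<longrightarrow> v x = 0) \<and>
    (\<forall>g\<in>T. mderiv v (A g) = 0)"
  using assms(1)
proof (induction T rule: finite_ranking_induct[where f = "\<lambda>g. rank (lead g)"])
  case empty
  show ?case by (rule exI[of _ "\<lambda>x. if x = b then 1 else 0"]) (use proper in auto)
next
  case (insert g T)
  then obtain v where v: "v b \<notin> lincombs A" "\<And>x. x \<notin> lead ` T \<Longrightarrow> x \<noteq> b \<Longrightarrow> v x = 0"
      "\<And>h. h \<in> T \<Longrightarrow> mderiv v (A h) = 0"
    by auto
  show ?case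
  proof (cases "g \<in> T")
    case True
    with v show ?thesis by (auto simp: insert_absorb)
  next
    case False
    define s where "s = mpartial (lead g) (A g)"
    \<comment> \<open>The old solution scaled by the separant \<open>s\<close>, and the value at the new lead that solves the new equation\<close>
    define w where "w = (\<lambda>x. s * v x + (- mderiv v (A g)) * (if x = lead g then 1 else 0))"
    have w: "mderiv w p = s * mderiv v p - mderiv v (A g) * mpartial (lead g) p" for p
      unfolding w_def by (subst mderiv_linear) simp
    have "mderiv w (A h) = 0" if "h \<in> T" for h
    proof -
      have "lead g \<notin> mvars (A h)"
        using insert that False by (intro lead_not_in_earlier) auto
      then have "mpartial (lead g) (A h) = 0" by (intro mderiv_eq_0) auto
      then show ?thesis using that v(3) by (simp add: w)
    qed
    moreover have "mderiv w (A g) = 0" by (simp add: w s_def)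
    moreover have "w b \<notin> lincombs A"
      using assms(2) v(1) separant[of g] prime[of s "v b"] by (auto simp: w_def s_def)
    moreover have "w x = 0" if "x \<notin> lead ` insert g T" "x \<noteq> b" for x
      using that v(2)[of x] by (auto simp: w_def)
    ultimately show ?thesis by (intro exI[of _ w]) blast
  qed
qed

text \<open>A derivation which annihilates the generators occurring in \<open>p\<close> sends \<open>p\<close> into the ideal. On a polynomial
in the non-leads, the derivation along a tangent vector concentrated in \<open>b\<close> is \<open>\<partial>/\<partial>b\<close> up to a
factor outside the prime ideal.\<close>

lemma mpartial_in_lincombs:
  assumes "p \<in> lincombs A" "mvars p \<inter> range lead = {}" "b \<notin> range lead"
  shows "mpartial b p \<in> lincombs A"
proof -
  obtain T f where T: "finite T" "p = (\<Sum>g\<in>T. f g * A g)"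
    using assms(1) by (auto simp: lincombs_def)
  obtain v where v: "v b \<notin> lincombs A" "\<And>x. x \<notin> lead ` T \<Longrightarrow> x \<noteq> b \<Longrightarrow> v x = 0"
      "\<And>g. g \<in> T \<Longrightarrow> mderiv v (A g) = 0"
    using tangent_vector[OF T(1) assms(3)] by blast
  have "mderiv v p = (\<Sum>g\<in>T. mderiv v (f g) * A g)"
    by (simp add: T(2) mderiv_sum mderiv_mult v(3))
  then have "mderiv v p \<in> lincombs A"
    using T(1) by (intro lincombsI)
  also have "mderiv v p = mderiv (\<lambda>x. v b * (if x = b then 1 else 0)) p"
    by (rule mderiv_cong) (use assms(2) v(2) in fastforce)
  also have "\<dots> = v b * mpartial b p" by (rule mderiv_scale)
  finally show ?thesis using prime v(1) by blast
qed

lemma const_not_in_lincombs: "c \<noteq> 0 \<Longrightarrow> mconst c \<notin> lincombs A"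
  using proper lincombs_mult[of "mconst c" A "mconst (1 / c)"] by (auto simp flip: mconst_mult)

text \<open>The Jacobian criterion in characteristic \<open>0\<close>: by induction on the degree the partial derivatives
of a relation vanish, so the relation is constant, and the ideal contains no nonzero constant.\<close>

lemma free_nonleads:
  assumes "p \<in> lincombs A" "mvars p \<inter> range lead = {}" shows "p = 0"
proof -
  define deg :: "('v \<Rightarrow>\<^sub>0 nat) \<Rightarrow> nat" where "deg m = (\<Sum>x\<in>Poly_Mapping.keys m. Poly_Mapping.lookup m x)" for m
  have deg_Suc: "deg (m + Poly_Mapping.single x 1) = Suc (deg m)" for m x
  proof -
    let ?S = "insert x (Poly_Mapping.keys m)"
    have sup: "deg n = (\<Sum>y\<in>?S. Poly_Mapping.lookup n y)" if "Poly_Mapping.keys n \<subseteq> ?S" for n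
      unfolding deg_def by (rule sum.mono_neutral_left) (use that in \<open>auto simp: in_keys_iff\<close>)
    have "Poly_Mapping.keys (m + Poly_Mapping.single x 1) \<subseteq> ?S"
      using keys_add[of m "Poly_Mapping.single x 1"] by auto
    then have "deg (m + Poly_Mapping.single x 1) =
        (\<Sum>y\<in>?S. Poly_Mapping.lookup m y + (if x = y then 1 else 0))"
      by (subst sup) (simp_all add: lookup_add lookup_single when_def del: One_nat_def)
    also have "\<dots> = (\<Sum>y\<in>?S. Poly_Mapping.lookup m y) + (\<Sum>y\<in>?S. if x = y then 1 else 0)"
      by (rule sum.distrib)
    also have "(\<Sum>y\<in>?S. if x = y then 1 else 0) = (1::nat)"
      by (subst sum.delta') auto
    also have "(\<Sum>y\<in>?S. Poly_Mapping.lookup m y) = deg m"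
      by (rule sup[symmetric]) auto
    finally show ?thesis by simp
  qed
  have const: "p = 0" if "\<And>m. m \<in> Poly_Mapping.keys p \<Longrightarrow> m = 0" "p \<in> lincombs A" for p
  proof -
    have "p = mconst (Poly_Mapping.lookup p 0)"
    proof (rule poly_mapping_eqI)
      fix m
      show "Poly_Mapping.lookup p m = Poly_Mapping.lookup (mconst (Poly_Mapping.lookup p 0)) m"
        using that(1)[of m] by (cases "m = 0") (auto simp: mconst_def lookup_single in_keys_iff)
    qed
    then show ?thesis
      using that(2) const_not_in_lincombs[of "Poly_Mapping.lookup p 0"] by (metis mconst_0)
  qed
  have "p = 0" if "\<And>m. m \<in> Poly_Mapping.keys p \<Longrightarrow> deg m \<le> N" "p \<in> lincombs A"
      "mvars p \<inter> range lead = {}" for p N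
    using that
  proof (induction N arbitrary: p)
    case 0
    have "m = 0" if "m \<in> Poly_Mapping.keys p" for m
      using 0(1)[OF that] by (intro poly_mapping_eqI) (auto simp: deg_def in_keys_iff)
    then show ?case using const 0(2) by blast
  next
    case (Suc N)
    have key: "m + Poly_Mapping.single x 1 \<in> Poly_Mapping.keys p"
      if "m \<in> Poly_Mapping.keys (mpartial x p)" for m x
      using that by (auto simp: in_keys_iff lookup_mpartial)
    have zero: "mpartial x p = 0" if "x \<notin> range lead" for x
    proof (rule Suc.IH)
      show "mpartial x p \<in> lincombs A"
        by (rule mpartial_in_lincombs[OF Suc.prems(2,3) that])
      show "deg m \<le> N" if "m \<in> Poly_Mapping.keys (mpartial x p)" for m
        using Suc.prems(1)[OF key[OF that]] by (simp only: deg_Suc)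
      have "Poly_Mapping.keys m \<subseteq> mvars p" if "m \<in> Poly_Mapping.keys (mpartial x p)" for m
      proof
        fix y assume "y \<in> Poly_Mapping.keys m"
        then have "y \<in> Poly_Mapping.keys (m + Poly_Mapping.single x 1)"
          by (simp add: in_keys_iff lookup_add)
        then show "y \<in> mvars p"
          using key[OF that] by (auto simp: mvars_def)
      qed
      then show "mvars (mpartial x p) \<inter> range lead = {}"
        using Suc.prems(3) by (auto simp: mvars_def[of "mpartial x p"])
    qed
    have "m = 0" if m: "m \<in> Poly_Mapping.keys p" for m
    proof (rule ccontr)
      assume "m \<noteq> 0"
      then obtain x where x: "x \<in> Poly_Mapping.keys m"
        by (metis ex_in_conv keys_eq_empty)
      then have "x \<notin> range lead"
        using m Suc.prems(3) by (auto simp: mvars_def)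
      moreover have "m - Poly_Mapping.single x 1 + Poly_Mapping.single x 1 = m"
        using x by (intro poly_mapping_eqI)
          (auto simp: lookup_add lookup_minus lookup_single when_def in_keys_iff)
      ultimately have "of_nat (Suc (Poly_Mapping.lookup (m - Poly_Mapping.single x 1) x)) *
          Poly_Mapping.lookup p m = 0"
        using lookup_mpartial[of x p "m - Poly_Mapping.single x 1"] zero[of x] by simp
      with m show False by (simp only: mult_eq_0_iff of_nat_eq_0_iff in_keys_iff) simp
    qed
    then show ?case using const Suc.prems(2) by blast
  qed
  moreover have "deg m \<le> Max (deg ` Poly_Mapping.keys p)" if "m \<in> Poly_Mapping.keys p" for m
    using that by simp
  ultimately show ?thesis using assms by blast
qed

end

section \<open>Transcendence degree at a generic point of a triangular system\<close>

text \<open>Transitivity of algebraicity: the coefficients of \<open>f\<close> generate a finite extension of \<open>F\<close>, over which \<open>x\<close>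
generates another one.\<close>

lemma (in field) algebraic_over_algebraics:
  assumes F: "subfield F R" and x: "x \<in> carrier R" and f: "set f \<subseteq> {y \<in> carrier R. algebraic F y}"
    and "f \<noteq> []" "Polynomials.lead_coeff f \<noteq> \<zero>" "eval f x = \<zero>"
  shows "algebraic F x"
proof -
  \<comment> \<open>The coefficients lie in the finite extension \<open>E\<close> of \<open>F\<close> that they generate.\<close>
  define E where "E = finite_extension F f"
  have sub: "subfield E R" and fin: "finite_dimension F E"
    unfolding E_def using f
    by (intro finite_extension_is_subfield finite_extension_finite_dimension(1) F; auto simp: over_def)+
  have "set f \<subseteq> E"
    unfolding E_def using f by (intro finite_extension_mem subfieldE(1)[OF F]) auto
  then have "f \<in> carrier (E [X])"
    using assms(5) by (simp add: polynomial_def flip: univ_poly_carrier)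
  then have "(algebraic over E) x"
    using assms(4,6) by (intro algebraicI)
  then have "finite_dimension E (simple_extension E x)"
    using finite_dimension_simple_extension[OF sub x] by simp
  then have "finite_dimension F (simple_extension E x)"
    using telescopic_base_dim(1)[OF F sub fin] by simp
  moreover have "subring (simple_extension E x) R"
    by (rule simple_extension_is_subring[OF subfieldE(1)[OF sub] x])
  moreover have "x \<in> simple_extension E x"
    by (rule simple_extension_mem[OF subfieldE(1)[OF sub] x])
  ultimately show ?thesis
    using finite_dimension_imp_algebraic[OF F, of "simple_extension E x" x] by (simp add: over_def)
qed

text \<open>Polynomials are computed with as elements of a type, their values as elements of a carrier set. This
locale is the passage between the two.\<close>

locale type_ring_hom = field L for L :: "('l, 'm) ring_scheme" (structure) +
  fixes h :: "'a::comm_ring_1 \<Rightarrow> 'l"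
  assumes h_closed [simp]: "h a \<in> carrier L" and h_add: "h (a + b) = h a \<oplus> h b"
    and h_mult: "h (a * b) = h a \<otimes> h b" and h_one [simp]: "h 1 = \<one>"
begin

lemma h_zero [simp]: "h 0 = \<zero>"
  using h_add[of 0 0] by (metis add.r_cancel_one h_closed add_0)

lemma h_uminus: "h (- a) = \<ominus> h a"
  using h_add[of "- a" a] by (intro minus_equality[symmetric]) simp_all

lemma h_diff: "h (a - b) = h a \<ominus> h b"
  using h_add[of a "- b"] by (simp add: h_uminus a_minus_def)

lemma h_sum_eq_zero: "(\<And>x. x \<in> S \<Longrightarrow> h (f x) = \<zero>) \<Longrightarrow> h (sum f S) = \<zero>"
  by (induction S rule: infinite_finite_induct) (simp_all add: h_add)

lemma h_sum: "h (sum f S) = (\<Oplus>x\<in>S. h (f x))"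
proof (cases "finite S")
  case True
  then show ?thesis
    by (induction rule: finite_induct) (simp_all add: h_add finsum_insert Pi_def)
qed (simp add: finsum_infinite)

lemma h_prod: "h (prod f S) = (\<Otimes>x\<in>S. h (f x))"
proof (cases "finite S")
  case True
  then show ?thesis
    by (induction rule: finite_induct) (simp_all add: h_mult finprod_insert Pi_def)
qed (simp add: finprod_infinite)

lemma h_power: "h (a ^ n) = h a [^] n"
  by (induction n) (simp_all add: h_mult m_comm)

lemma eval_image:
  "eval (map (\<lambda>i. h (c i)) (rev [0..<n])) (h a) = h (\<Sum>i<n. c i * a ^ i)"
  by (induction n) (simp_all add: h_add h_mult h_power a_comm)

text \<open>A root of a polynomial that is allowed to have leading coefficients with value \<open>0\<close>, as long as some
coefficient has a nonzero value.\<close>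

lemma algebraic_if_root:
  assumes "subfield F L" "\<And>i. h (Polynomial.coeff f i) \<in> {y \<in> carrier L. algebraic F y}"
    and "h (poly f a) = \<zero>" "h (Polynomial.coeff f i) \<noteq> \<zero>"
  shows "algebraic F (h a)"
proof -
  define n where "n = (GREATEST i. h (Polynomial.coeff f i) \<noteq> \<zero>)"
  have bound: "j \<le> Polynomial.degree f" if "h (Polynomial.coeff f j) \<noteq> \<zero>" for j
    using that by (metis h_zero le_degree)
  have n: "h (Polynomial.coeff f n) \<noteq> \<zero>"
    unfolding n_def by (rule GreatestI_nat[where P = "\<lambda>i. h (Polynomial.coeff f i) \<noteq> \<zero>"]) (use assms(4) bound in auto)
  have above: "h (Polynomial.coeff f j) = \<zero>" if "j > n" for j
    using that Greatest_le_nat[where P = "\<lambda>i. h (Polynomial.coeff f i) \<noteq> \<zero>", OF _ bound] unfolding n_def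
    by (meson not_le)
  define N where "N = max (Suc n) (Suc (Polynomial.degree f))"
  have "poly f a = (\<Sum>i\<le>Polynomial.degree f. Polynomial.coeff f i * a ^ i)"
    by (rule poly_altdef)
  also have "\<dots> = (\<Sum>i<N. Polynomial.coeff f i * a ^ i)"
    by (rule sum.mono_neutral_left) (auto simp: N_def coeff_eq_0)
  also have "\<dots> = (\<Sum>i<Suc n. Polynomial.coeff f i * a ^ i) + (\<Sum>i=Suc n..<N. Polynomial.coeff f i * a ^ i)"
    by (metis N_def lessThan_atLeast0 max.cobounded1 sum.atLeastLessThan_concat zero_le)
  also have "h \<dots> = h (\<Sum>i<Suc n. Polynomial.coeff f i * a ^ i) \<oplus> h (\<Sum>i=Suc n..<N. Polynomial.coeff f i * a ^ i)"
    by (rule h_add)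
  also have "h (\<Sum>i=Suc n..<N. Polynomial.coeff f i * a ^ i) = \<zero>"
    by (rule h_sum_eq_zero) (simp add: h_mult above)
  finally have "h (\<Sum>i<Suc n. Polynomial.coeff f i * a ^ i) = \<zero>"
    using assms(3) by simp
  then have "eval (map (\<lambda>i. h (Polynomial.coeff f i)) (rev [0..<Suc n])) (h a) = \<zero>"
    by (simp only: eval_image)
  then show ?thesis
    by (rule algebraic_over_algebraics[OF assms(1) h_closed, rotated 3])
      (use assms(2) n in auto)
qed

end

locale generic_point = type_ring_hom L h
  for L :: "('l, 'm) ring_scheme" (structure) and h :: "(('v::linorder \<Rightarrow>\<^sub>0 nat) \<Rightarrow>\<^sub>0 'k::field_char_0) \<Rightarrow> 'l"
begin

abbreviation scalar :: "'k \<Rightarrow> 'l" where "scalar c \<equiv> h (mconst c)"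
abbreviation coord :: "'v \<Rightarrow> 'l" where "coord x \<equiv> h (mvar x)"

lemma h_msubst:
  assumes "\<And>b. b \<in> mvars p \<Longrightarrow> coord (g b) = b"
  shows "h (msubst mconst (\<lambda>b. mvar (g b)) p) = mpoly_eval L scalar p"
proof -
  have carrier: "b \<in> carrier L" if "b \<in> mvars p" for b
    using assms[OF that] h_closed[of "mvar (g b)"] by simp
  have closed: "(\<Otimes>b\<in>Poly_Mapping.keys m. b [^] Poly_Mapping.lookup m b) \<in> carrier L"
    if "m \<in> Poly_Mapping.keys p" for m
    by (rule finprod_closed) (use that carrier in \<open>auto simp: mvars_def\<close>)
  have monomial: "(\<Otimes>b\<in>Poly_Mapping.keys m. h (mvar (g b) ^ Poly_Mapping.lookup m b)) =
      (\<Otimes>b\<in>Poly_Mapping.keys m. b [^] Poly_Mapping.lookup m b)"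
    if "m \<in> Poly_Mapping.keys p" for m
  proof (rule finprod_cong'[OF refl])
    show "(\<lambda>b. b [^] Poly_Mapping.lookup m b) \<in> Poly_Mapping.keys m \<rightarrow> carrier L"
      using that carrier by (auto simp: mvars_def)
    fix b assume "b \<in> Poly_Mapping.keys m"
    then have "coord (g b) = b" using that assms by (auto simp: mvars_def)
    then show "h (mvar (g b) ^ Poly_Mapping.lookup m b) = b [^] Poly_Mapping.lookup m b"
      by (simp add: h_power)
  qed
  have "h (msubst mconst (\<lambda>b. mvar (g b)) p) = (\<Oplus>m\<in>Poly_Mapping.keys p.
      scalar (Poly_Mapping.lookup p m) \<otimes>
      (\<Otimes>b\<in>Poly_Mapping.keys m. h (mvar (g b) ^ Poly_Mapping.lookup m b)))"
    by (simp only: msubst_def meval_def h_sum h_mult h_prod)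
  also have "\<dots> = mpoly_eval L scalar p"
    unfolding mpoly_eval_def
  proof (rule finsum_cong'[OF refl])
    show "(\<lambda>m. scalar (Poly_Mapping.lookup p m) \<otimes>
        (\<Otimes>b\<in>Poly_Mapping.keys m. b [^] Poly_Mapping.lookup m b)) \<in> Poly_Mapping.keys p \<rightarrow> carrier L"
      using closed by (simp add: Pi_def)
  qed (simp only: monomial)
  finally show ?thesis .
qed

text \<open>Algebraic independence is about polynomials whose variables are elements of \<open>L\<close>. Renaming an element
of \<open>B\<close>'s image to the indeterminate above it turns such a relation into a polynomial vanishing at the generic
point, and renaming back recovers the relation.\<close>

lemma algebraically_independent_coords:
  assumes "\<And>p. mvars p \<subseteq> B \<Longrightarrow> h p = \<zero> \<Longrightarrow> p = 0"
  shows "inj_on coord B" "algebraically_independent L scalar (coord ` B)"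
proof -
  show inj: "inj_on coord B"
  proof (rule inj_onI)
    fix x y assume xy: "x \<in> B" "y \<in> B" "coord x = coord y"
    have "h (mvar x - mvar y) = \<zero>"
      using xy by (simp add: h_diff a_minus_def r_neg)
    moreover have "mvars (mvar x - mvar y :: ('v \<Rightarrow>\<^sub>0 nat) \<Rightarrow>\<^sub>0 'k) \<subseteq> B"
      using xy mvars_diff[of "mvar x" "mvar y :: ('v \<Rightarrow>\<^sub>0 nat) \<Rightarrow>\<^sub>0 'k"] by auto
    ultimately have "mvar x = (mvar y :: ('v \<Rightarrow>\<^sub>0 nat) \<Rightarrow>\<^sub>0 'k)"
      using assms[of "mvar x - mvar y"] by simp
    then show "x = y" by (metis mvars_var singleton_iff)
  qed
  show "algebraically_independent L scalar (coord ` B)"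
    unfolding algebraically_independent_def
  proof (intro conjI allI impI)
    fix p :: "('l \<Rightarrow>\<^sub>0 nat) \<Rightarrow>\<^sub>0 'k"
    assume p: "(\<forall>m\<in>Poly_Mapping.keys p. Poly_Mapping.keys m \<subseteq> coord ` B) \<and> mpoly_eval L scalar p = \<zero>"
    then have vars: "mvars p \<subseteq> coord ` B" by (auto simp: mvars_def)
    define g where "g = inv_into B coord"
    have g: "g b \<in> B" "coord (g b) = b" if "b \<in> coord ` B" for b
      using inv_into_into[OF that] f_inv_into_f[OF that] by (simp_all add: g_def)
    define q :: "('v \<Rightarrow>\<^sub>0 nat) \<Rightarrow>\<^sub>0 'k" where "q = msubst mconst (\<lambda>b. mvar (g b)) p"
    have "h q = mpoly_eval L scalar p"
      unfolding q_def by (rule h_msubst) (use vars g(2) in blast)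
    then have "h q = \<zero>" using p by simp
    moreover have "mvars q \<subseteq> B"
      unfolding q_def by (rule mvars_msubst[OF vars]) (use g(1) in auto)
    ultimately have "q = 0" using assms by blast
    have "msubst mconst (\<lambda>x. mvar (coord x)) (msubst mconst (\<lambda>b. mvar (g b)) p) = p"
      using vars
      by (induction p rule: mpoly_induct) (simp_all add: g(2) mc.msubst_add mc.msubst_mult)
    then show "p = 0" using \<open>q = 0\<close> by (simp add: q_def)
  qed auto
qed

text \<open>Consider \<open>p\<close> as a polynomial in \<open>x\<close> alone. If all its coefficients vanished at the generic point, so would its
derivative, whatever the degree in \<open>x\<close> may be.\<close>

lemma algebraic_if_simple_root:
  assumes "subfield F L" "mvars p \<subseteq> insert x V"
    and V: "\<And>y. y \<in> V \<Longrightarrow> y \<noteq> x \<Longrightarrow> algebraic F (coord y)" and scalars: "range scalar \<subseteq> F"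
    and "h p = \<zero>" "h (mpartial x p) \<noteq> \<zero>"
  shows "algebraic F (coord x)"
proof -
  define C where "C = {y \<in> carrier L. algebraic F y}"
  have C: "subring C L"
    unfolding C_def using subfield_of_algebraics[OF assms(1)] subfieldE(1) by (simp add: over_def)
  \<comment> \<open>\<open>f q\<close> is \<open>q\<close> as a polynomial in \<open>x\<close> with the other variables in the coefficients.\<close>
  define f where "f = msubst (\<lambda>c. [:mconst c :: ('v \<Rightarrow>\<^sub>0 nat) \<Rightarrow>\<^sub>0 'k:])
    (\<lambda>y. if y = x then [:0, 1:] else [:mvar y:])"
  have val: "poly (f q) (mvar x) = q" for q
    unfolding f_def
    by (rule mpoly_induct[of q UNIV]) (simp_all add: mcp.msubst_add mcp.msubst_mult)
  have der: "poly (pderiv (f q)) (mvar x) = mpartial x q" for q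
  proof (rule mpoly_induct[of q UNIV])
    fix q r assume "poly (pderiv (f q)) (mvar x) = mpartial x q"
      "poly (pderiv (f r)) (mvar x) = mpartial x r"
    moreover have "f (q * r) = f q * f r"
      by (simp add: f_def mcp.msubst_mult)
    ultimately show "poly (pderiv (f (q * r))) (mvar x) = mpartial x (q * r)"
      by (simp add: pderiv_mult val mderiv_mult)
  qed (simp_all add: f_def mcp.msubst_add pderiv_add mderiv_add pderiv_pCons)
  have coeffs: "h (Polynomial.coeff (f p) i) \<in> C" for i
    using assms(2)
  proof (induction p arbitrary: i rule: mpoly_induct)
    case (const c)
    have "scalar c \<in> C"
      using algebraic_self[OF subfieldE(1)[OF assms(1)], of "scalar c"] scalars
      by (auto simp: C_def over_def)
    then show ?case using subringE(2)[OF C] by (simp add: f_def coeff_pCons split: nat.split)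
  next
    case (var y)
    then show ?case
      using V[of y] subringE(2,3)[OF C] by (auto simp: C_def f_def coeff_pCons split: nat.split)
  next
    case (add q r)
    then show ?case using subringE(7)[OF C] by (simp add: f_def mcp.msubst_add h_add)
  next
    case (mult q r)
    then have closed: "h (Polynomial.coeff (f q) j * Polynomial.coeff (f r) k) \<in> C" for j k
      using subringE(6)[OF C] by (simp add: h_mult)
    have "h (\<Sum>j\<in>S. c j) \<in> C" if "finite S" "\<And>j. h (c j) \<in> C" for S :: "nat set" and c
      using that by (induction rule: finite_induct) (simp_all add: h_add subringE(2,7)[OF C])
    moreover have "f (q * r) = f q * f r"
      by (simp add: f_def mcp.msubst_mult)
    ultimately show ?case using closed by (simp add: coeff_mult)
  qed
  have "\<exists>i. h (Polynomial.coeff (f p) i) \<noteq> \<zero>"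
  proof (rule ccontr)
    assume "\<not> (\<exists>i. h (Polynomial.coeff (f p) i) \<noteq> \<zero>)"
    then have "h (poly (pderiv (f p)) (mvar x)) = \<zero>"
      by (simp add: poly_altdef h_sum h_mult coeff_pderiv)
    with assms(6) show False by (simp add: der)
  qed
  then obtain i where "h (Polynomial.coeff (f p) i) \<noteq> \<zero>" ..
  then show ?thesis
    using algebraic_if_root[OF assms(1), of "f p" "mvar x" i] coeffs assms(5) by (simp add: val C_def)
qed

text \<open>The closedness condition on \<open>V\<close> is what orderly leads provide for balls: an equation whose lead lies in the ball
lies in the ball entirely, so the induction on the rank does not leave \<open>V\<close>.\<close>

theorem has_tr_deg_nonleads:
  fixes A :: "'g \<Rightarrow> ('v \<Rightarrow>\<^sub>0 nat) \<Rightarrow>\<^sub>0 'k" and rank :: "'v \<Rightarrow> nat"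
  assumes rank: "\<And>g x. x \<in> mvars (A g) \<Longrightarrow> x \<noteq> lead g \<Longrightarrow> rank x < rank (lead g)"
    and roots: "\<And>g. h (A g) = \<zero>" and simple: "\<And>g. h (mpartial (lead g) (A g)) \<noteq> \<zero>"
    and free: "\<And>p. h p = \<zero> \<Longrightarrow> mvars p \<inter> range lead = {} \<Longrightarrow> p = 0"
    and V: "finite V" "\<And>g. lead g \<in> V \<Longrightarrow> mvars (A g) \<subseteq> V"
  shows "has_tr_deg L scalar (generate_field L (range scalar \<union> coord ` V)) (card (V - range lead))"
proof -
  define B where "B = V - range lead"
  define F where "F = generate_field L (range scalar \<union> coord ` B)"
  have F: "subfield F L"
    unfolding F_def by (rule generate_field_is_subfield) auto
  have incl: "range scalar \<subseteq> F" "coord ` B \<subseteq> F"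
    by (auto simp: F_def intro: generate_field.incl)
  define C where "C = {y \<in> carrier L. algebraic F y}"
  have C: "subfield C L"
    unfolding C_def using subfield_of_algebraics[OF F] by (simp add: over_def)
  have FC: "F \<subseteq> C"
    using algebraic_self[OF subfieldE(1)[OF F]] subfieldE(3)[OF F] by (auto simp: C_def over_def)
  have "coord x \<in> C" if "x \<in> V" for x
    using that
  proof (induction "rank x" arbitrary: x rule: less_induct)
    case less
    show ?case
    proof (cases "x \<in> range lead")
      case False
      then show ?thesis using less.prems incl FC by (auto simp: B_def)
    next
      case True
      then obtain g where g: "x = lead g" by auto
      let ?W = "mvars (A g)"
      have "algebraic F (coord x)"
      proof (rule algebraic_if_simple_root[OF F _ _ incl(1)])
        show "mvars (A g) \<subseteq> insert x ?W" by auto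
        show "algebraic F (coord y)" if "y \<in> ?W" "y \<noteq> x" for y
          using less.hyps[of y] rank[of y g] V(2)[of g] less.prems that g by (auto simp: C_def)
        show "h (A g) = \<zero>" by (rule roots)
        show "h (mpartial x (A g)) \<noteq> \<zero>" using simple g by simp
      qed
      then show ?thesis by (simp add: C_def)
    qed
  qed
  then have "generate_field L (range scalar \<union> coord ` V) \<subseteq> C"
    using incl(1) FC by (intro generate_field_min_subfield1[OF _ C]) auto
  moreover have indep: "inj_on coord B" "algebraically_independent L scalar (coord ` B)"
    by (rule algebraically_independent_coords; use free B_def in blast)+
  ultimately have "transcendence_basis L scalar
      (generate_field L (range scalar \<union> coord ` V)) (coord ` B)"
    unfolding transcendence_basis_def
    by (auto simp: B_def C_def F_def intro: generate_field.incl)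
  then show ?thesis
    unfolding has_tr_deg_def using V(1) card_image[OF indep(1)] by (auto simp: B_def)
qed

end

section \<open>Difference ideals and their quotient fields\<close>

lemma spoly_ring_simps [simp]:
  "carrier spoly_ring = UNIV" "p \<otimes>\<^bsub>spoly_ring\<^esub> q = p * q" "p \<oplus>\<^bsub>spoly_ring\<^esub> q = p + q"
  "\<one>\<^bsub>spoly_ring\<^esub> = 1" "\<zero>\<^bsub>spoly_ring\<^esub> = 0"
  by (simp_all add: spoly_ring_def ring_of_type_algebra_def)

lemma cring_spoly_ring: "cring spoly_ring"
  unfolding spoly_ring_def by (rule cring_from_type_algebra)

lemma ideal_lincombs: "ideal (lincombs A) spoly_ring"
proof -
  interpret cring spoly_ring by (rule cring_spoly_ring)
  show ?thesis
  proof (rule idealI)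
    show "subgroup (lincombs A) (add_monoid spoly_ring)"
    proof (rule add.subgroupI)
      show "lincombs A \<noteq> {}" using lincombs_0 by blast
      fix p assume p: "p \<in> lincombs A"
      have "\<ominus>\<^bsub>spoly_ring\<^esub> p = - p"
        by (rule minus_equality) simp_all
      then show "\<ominus>\<^bsub>spoly_ring\<^esub> p \<in> lincombs A"
        using lincombs_uminus[OF p] by simp
    qed (simp_all add: lincombs_add)
  qed (simp_all add: ring_axioms lincombs_mult lincombs_mult_right)
qed

lemma sideal_singleton: "sideal \<alpha>1 \<alpha>2 {p} = lincombs (\<lambda>\<gamma>. spoly_act \<alpha>1 \<alpha>2 \<gamma> p)"
proof -
  let ?A = "\<lambda>\<gamma>. spoly_act \<alpha>1 \<alpha>2 \<gamma> p"
  interpret cring spoly_ring by (rule cring_spoly_ring)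
  have gen: "sideal \<alpha>1 \<alpha>2 {p} = Idl\<^bsub>spoly_ring\<^esub> (range ?A)"
    unfolding sideal_def by (rule arg_cong[where f = "genideal spoly_ring"]) auto
  interpret I: ideal "Idl\<^bsub>spoly_ring\<^esub> (range ?A)" spoly_ring
    by (rule genideal_ideal) simp
  have "(\<Sum>\<gamma>\<in>T. f \<gamma> * ?A \<gamma>) \<in> Idl\<^bsub>spoly_ring\<^esub> (range ?A)" if "finite T" for T f
    using that
  proof (induction rule: finite_induct)
    case (insert \<gamma> T)
    have "?A \<gamma> \<in> Idl\<^bsub>spoly_ring\<^esub> (range ?A)"
      using genideal_self[of "range ?A"] by auto
    then show ?case
      using insert I.I_l_closed[of "?A \<gamma>" "f \<gamma>"] I.a_closed by simp
  qed (use I.zero_closed in simp)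
  then have "lincombs ?A \<subseteq> Idl\<^bsub>spoly_ring\<^esub> (range ?A)"
    by (auto simp: lincombs_def)
  moreover have "Idl\<^bsub>spoly_ring\<^esub> (range ?A) \<subseteq> lincombs ?A"
    using lincombs_gen by (intro genideal_minimal ideal_lincombs) auto
  ultimately show ?thesis using gen by simp
qed

context
  fixes P :: "('i, 'k::field_char_0) spoly set"
  assumes P: "primeideal P spoly_ring"
begin

lemma type_ring_hom_to_quotient_field:
  "type_ring_hom (quotient_field (quot_ring P)) (to_quotient_field P)"
proof -
  interpret primeideal P spoly_ring by (rule P)
  interpret D: domain "quot_ring P"
    unfolding quot_ring_def by (rule quotient_is_domain)
  interpret hom: ring_hom_cring spoly_ring "quot_ring P" "(+>\<^bsub>spoly_ring\<^esub>) P"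
    unfolding quot_ring_def by (rule rcos_ring_hom_cring)
  have closed: "P +>\<^bsub>spoly_ring\<^esub> p \<in> carrier (quot_ring P)" for p
    using hom.hom_closed[of p] by simp
  show ?thesis
  proof (intro type_ring_hom.intro type_ring_hom_axioms.intro D.field_quotient_field)
    fix p q :: "('i, 'k) spoly"
    show "to_quotient_field P p \<in> carrier (quotient_field (quot_ring P))"
      unfolding to_quotient_field_def using closed by (intro D.fraction_in_carrier) auto
    show "to_quotient_field P (p + q) =
        to_quotient_field P p \<oplus>\<^bsub>quotient_field (quot_ring P)\<^esub> to_quotient_field P q"
      using hom.hom_add[of p q] closed by (simp add: to_quotient_field_def D.add_fraction)
    show "to_quotient_field P (p * q) =
        to_quotient_field P p \<otimes>\<^bsub>quotient_field (quot_ring P)\<^esub> to_quotient_field P q"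
      using hom.hom_mult[of p q] closed by (simp add: to_quotient_field_def D.mult_fraction)
    show "to_quotient_field P 1 = \<one>\<^bsub>quotient_field (quot_ring P)\<^esub>"
      using hom.hom_one by (simp add: to_quotient_field_def quotient_field_def)
  qed
qed

lemma to_quotient_field_eq_0_iff:
  "to_quotient_field P p = \<zero>\<^bsub>quotient_field (quot_ring P)\<^esub> \<longleftrightarrow> p \<in> P"
proof -
  interpret primeideal P spoly_ring by (rule P)
  interpret D: domain "quot_ring P"
    unfolding quot_ring_def by (rule quotient_is_domain)
  interpret hom: ring_hom_cring spoly_ring "quot_ring P" "(+>\<^bsub>spoly_ring\<^esub>) P"
    unfolding quot_ring_def by (rule rcos_ring_hom_cring)
  have "\<zero>\<^bsub>quotient_field (quot_ring P)\<^esub> = fraction (quot_ring P) \<zero>\<^bsub>quot_ring P\<^esub> \<one>\<^bsub>quot_ring P\<^esub>"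
    by (simp add: quotient_field_def)
  moreover have "fraction (quot_ring P) (P +>\<^bsub>spoly_ring\<^esub> p) \<one>\<^bsub>quot_ring P\<^esub> =
      fraction (quot_ring P) \<zero>\<^bsub>quot_ring P\<^esub> \<one>\<^bsub>quot_ring P\<^esub> \<longleftrightarrow> P +>\<^bsub>spoly_ring\<^esub> p = \<zero>\<^bsub>quot_ring P\<^esub>"
    using hom.hom_closed[of p] by (subst D.fraction_eq_iff) auto
  moreover have "\<zero>\<^bsub>quot_ring P\<^esub> = P"
    by (simp add: quot_ring_def FactRing_def)
  ultimately have "to_quotient_field P p = \<zero>\<^bsub>quotient_field (quot_ring P)\<^esub> \<longleftrightarrow> P +>\<^bsub>spoly_ring\<^esub> p = P"
    unfolding to_quotient_field_def by simp
  also have "\<dots> \<longleftrightarrow> p \<in> P"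
    using a_rcos_zero[OF is_ideal, of p] rcos_const_imp_mem[of p] by auto
  finally show ?thesis .
qed

end

lemma finite_Gam: "finite (Gam r)"
  by (rule finite_subset[of _ "{- int r..int r} \<times> {- int r..int r}"])
    (auto simp: Gam_def gam_ord_def)

lemma coef_eq_mconst: "coef = mconst"
  by (simp add: fun_eq_iff coef_def mconst_def)

lemma ind_eq_mvar: "ind \<gamma> i = mvar (\<gamma>, i)"
  by (simp add: ind_def mvar_def)

lemma is_dimension_polynomial_if_separable:
  fixes p :: "('i::{finite, linorder}, 'k::field_char_0) spoly" and rank :: "gam \<times> 'i \<Rightarrow> nat"
  assumes "separable_triangular (\<lambda>\<gamma>. spoly_act \<alpha>1 \<alpha>2 \<gamma> p) lead rank"
    and closed: "\<And>r \<gamma>. r \<ge> N \<Longrightarrow> lead \<gamma> \<in> Gam r \<times> UNIV \<Longrightarrow> mvars (spoly_act \<alpha>1 \<alpha>2 \<gamma> p) \<subseteq> Gam r \<times> UNIV"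
    and count: "\<And>r. r \<ge> N \<Longrightarrow> poly \<psi> (of_nat r) = of_nat (card (Gam r \<times> UNIV - range lead))"
  shows "is_dimension_polynomial \<alpha>1 \<alpha>2 {p} \<psi>"
proof -
  define A where "A = (\<lambda>\<gamma>. spoly_act \<alpha>1 \<alpha>2 \<gamma> p)"
  interpret separable_triangular A lead rank
    unfolding A_def by (rule assms(1))
  define P where "P = lincombs A"
  have sideal: "sideal \<alpha>1 \<alpha>2 {p} = P"
    by (simp add: sideal_singleton P_def A_def)
  have prime: "primeideal P spoly_ring"
    unfolding P_def
  proof (rule primeidealI[OF ideal_lincombs cring_spoly_ring])
    show "carrier spoly_ring \<noteq> lincombs A" using proper by auto
  qed (use prime in auto)
  define L where "L = quotient_field (quot_ring P)"
  interpret generic_point L "to_quotient_field P"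
    unfolding generic_point_def L_def by (rule type_ring_hom_to_quotient_field[OF prime])
  have kernel: "to_quotient_field P q = \<zero>\<^bsub>L\<^esub> \<longleftrightarrow> q \<in> P" for q
    unfolding L_def by (rule to_quotient_field_eq_0_iff[OF prime])
  have "has_tr_deg L scalar (generate_field L (range scalar \<union>
      {to_quotient_field P (ind \<gamma> i) | \<gamma> i. \<gamma> \<in> Gam r})) (card (Gam r \<times> UNIV - range lead))"
    if "r \<ge> N" for r
  proof -
    have "{to_quotient_field P (ind \<gamma> i) | \<gamma> i. \<gamma> \<in> Gam r} = coord ` (Gam r \<times> UNIV)"
      by (auto simp: ind_eq_mvar)
    moreover have "has_tr_deg L scalar (generate_field L (range scalar \<union> coord ` (Gam r \<times> UNIV)))
        (card (Gam r \<times> UNIV - range lead))"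
    proof (rule has_tr_deg_nonleads)
      show "mvars (A \<gamma>) \<subseteq> Gam r \<times> UNIV" if "lead \<gamma> \<in> Gam r \<times> UNIV" for \<gamma>
        unfolding A_def by (rule closed[OF \<open>r \<ge> N\<close> that])
      show "q = 0" if "to_quotient_field P q = \<zero>\<^bsub>L\<^esub>" "mvars q \<inter> range lead = {}" for q
        using that free_nonleads kernel by (simp add: P_def)
      show "to_quotient_field P (A \<gamma>) = \<zero>\<^bsub>L\<^esub>" for \<gamma>
        using lincombs_gen[of A \<gamma>] by (intro kernel[THEN iffD2]) (simp add: P_def)
      show "to_quotient_field P (mpartial (lead \<gamma>) (A \<gamma>)) \<noteq> \<zero>\<^bsub>L\<^esub>" for \<gamma>
        using separant[of \<gamma>] kernel[of "mpartial (lead \<gamma>) (A \<gamma>)"] by (simp add: P_def)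
      show "rank x < rank (lead \<gamma>)" if "x \<in> mvars (A \<gamma>)" "x \<noteq> lead \<gamma>" for \<gamma> x
        using that by (rule rank_less)
    qed (simp add: finite_Gam)
    ultimately show ?thesis by simp
  qed
  then have "\<forall>\<^sub>F r in sequentially. \<exists>d. has_tr_deg L scalar (generate_field L (range scalar \<union>
      {to_quotient_field P (ind \<gamma> i) | \<gamma> i. \<gamma> \<in> Gam r})) d \<and> poly \<psi> (of_nat r) = of_nat d"
    using count by (intro eventually_sequentiallyI[of N]) blast
  then show ?thesis
    unfolding is_dimension_polynomial_def prime_system_def Let_def sideal coef_eq_mconst
    using prime by (simp add: L_def)
qed

lemma field_automorphism_inv:
  assumes "field_automorphism f" shows "field_automorphism (inv_into UNIV f)"
proof -
  have bij: "bij f" and f: "f 1 = 1" "\<And>x y. f (x + y) = f x + f y" "\<And>x y. f (x * y) = f x * f y"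
    using assms by (auto simp: field_automorphism_def)
  let ?g = "inv_into UNIV f"
  have inv: "?g y = x \<longleftrightarrow> f x = y" for x y
    using bij by (metis bij_inv_eq_iff)
  have g: "f (?g y) = y" for y using inv by blast
  show ?thesis
    unfolding field_automorphism_def using bij by (auto simp: inv f g bij_imp_bij_inv)
qed

lemma field_automorphism_funpow: "field_automorphism f \<Longrightarrow> field_automorphism (f ^^ n)"
  by (induction n) (auto simp: field_automorphism_def bij_comp)

lemma field_automorphism_gam_act:
  assumes "inversive_difference_field \<alpha>1 \<alpha>2"
  shows "field_automorphism (gam_act \<alpha>1 \<alpha>2 \<gamma>)"
proof -
  have "field_automorphism (int_iterate f k)" if "field_automorphism f" for f :: "'a \<Rightarrow> 'a" and k
    using that by (simp add: int_iterate_def field_automorphism_funpow field_automorphism_inv)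
  then have "field_automorphism (int_iterate \<alpha>1 (fst \<gamma>))" "field_automorphism (int_iterate \<alpha>2 (snd \<gamma>))"
    using assms by (simp_all add: inversive_difference_field_def)
  then show ?thesis
    by (auto simp: gam_act_def field_automorphism_def intro: bij_comp)
qed

lemma gam_act_constant:
  assumes "inversive_difference_field \<alpha>1 \<alpha>2" "is_constant \<alpha>1 \<alpha>2 a"
  shows "gam_act \<alpha>1 \<alpha>2 \<gamma> a = a"
proof -
  have "int_iterate f k a = a" if "bij f" "f a = a" for f :: "'a \<Rightarrow> 'a" and k
  proof -
    have pow: "(h ^^ n) a = a" if "h a = a" for h :: "'a \<Rightarrow> 'a" and n
      by (induction n) (simp_all add: that)
    have "inv_into UNIV f a = a" using that by (metis bij_inv_eq_iff)
    then show ?thesis by (simp add: int_iterate_def pow that(2))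
  qed
  then show ?thesis
    using assms by (simp add: gam_act_def inversive_difference_field_def field_automorphism_def is_constant_def)
qed

lemma spoly_act_eq_msubst:
  "spoly_act \<alpha>1 \<alpha>2 \<gamma> p =
    msubst (\<lambda>c. mconst (gam_act \<alpha>1 \<alpha>2 \<gamma> c)) (\<lambda>(\<delta>, i). mvar (\<gamma> + \<delta>, i)) p"
  by (simp add: spoly_act_def msubst_def meval_def coef_eq_mconst ind_eq_mvar case_prod_beta)

lemma coeff_hom_gam_act:
  assumes "inversive_difference_field \<alpha>1 \<alpha>2"
  shows "coeff_hom (\<lambda>c. mconst (gam_act \<alpha>1 \<alpha>2 \<gamma> c))"
proof -
  let ?f = "gam_act \<alpha>1 \<alpha>2 \<gamma>"
  have f: "?f 1 = 1" "\<And>x y. ?f (x + y) = ?f x + ?f y" "\<And>x y. ?f (x * y) = ?f x * ?f y"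
    using field_automorphism_gam_act[OF assms, of \<gamma>] by (auto simp: field_automorphism_def)
  moreover have "?f 0 = 0" using f(2)[of 0 0] by simp
  ultimately show ?thesis
    by unfold_locales (simp_all add: mconst_add mconst_mult)
qed

section \<open>The two schemes\<close>

lemma mvars_1 [simp]: "mvars (1 :: ('v \<Rightarrow>\<^sub>0 nat) \<Rightarrow>\<^sub>0 'k::comm_ring_1) = {}"
  using mvars_const[of 1] by simp

lemma mconst_numeral: "mconst (numeral n) = numeral n"
  by (simp add: mconst_def)

lemma mvars_subset_arith:
  "mvars p \<subseteq> V \<Longrightarrow> mvars q \<subseteq> V \<Longrightarrow> mvars (p + q) \<subseteq> V"
  "mvars p \<subseteq> V \<Longrightarrow> mvars q \<subseteq> V \<Longrightarrow> mvars (p - q) \<subseteq> V"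
  "mvars p \<subseteq> V \<Longrightarrow> mvars q \<subseteq> V \<Longrightarrow> mvars (p * q) \<subseteq> V"
  for p q :: "('v \<Rightarrow>\<^sub>0 nat) \<Rightarrow>\<^sub>0 'k::comm_ring_1"
  using mvars_add[of p q] mvars_diff[of p q] mvars_mult[of p q] by auto

lemma mvars_mpartial:
  assumes "mvars p \<subseteq> V" shows "mvars (mpartial x p) \<subseteq> V"
proof -
  have "mvars p \<subseteq> V \<and> mvars (mpartial x p) \<subseteq> V"
    using assms
  proof (induction p rule: mpoly_induct)
    case (var y)
    then show ?case by auto
  qed (simp_all add: mderiv_add mderiv_mult mvars_subset_arith)
  then show ?thesis ..
qed

lemma msubst_poly:
  fixes u :: "'w \<Rightarrow> ('v \<Rightarrow>\<^sub>0 nat) \<Rightarrow>\<^sub>0 'k::comm_ring_1"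
  assumes "coeff_hom (\<lambda>c. mconst (g c) :: ('v \<Rightarrow>\<^sub>0 nat) \<Rightarrow>\<^sub>0 'k)"
  shows "msubst (\<lambda>c. mconst (g c)) u (poly (map_poly mconst F) q) =
    poly (map_poly (\<lambda>c. mconst (g c)) F) (msubst (\<lambda>c. mconst (g c)) u q)"
proof -
  interpret coeff_hom "\<lambda>c. mconst (g c) :: ('v \<Rightarrow>\<^sub>0 nat) \<Rightarrow>\<^sub>0 'k" by (rule assms)
  show ?thesis
    by (induction F) (simp_all add: map_poly_pCons msubst_add msubst_mult)
qed

lemma mvars_poly_map_poly:
  fixes f :: "'c::comm_ring_1 \<Rightarrow> ('v \<Rightarrow>\<^sub>0 nat) \<Rightarrow>\<^sub>0 'k::comm_ring_1"
  assumes "\<And>c. mvars (f c) \<subseteq> V" "mvars q \<subseteq> V" "f 0 = 0"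
  shows "mvars (poly (map_poly f F) q) \<subseteq> V"
  by (induction F) (simp_all add: assms map_poly_pCons mvars_subset_arith)

lemma linear_in_fresh_variable_nonzero:
  fixes p :: "('v \<Rightarrow>\<^sub>0 nat) \<Rightarrow>\<^sub>0 'k::field_char_0"
  assumes "mvars p \<subseteq> V" "x \<notin> V" "a \<noteq> 0"
  shows "mconst a * mvar x + p \<noteq> 0"
proof
  assume "mconst a * mvar x + p = 0"
  then have "mpartial x (mconst a * mvar x + p) = 0" by simp
  moreover have "mpartial x p = 0"
    by (rule mderiv_eq_0) (use assms in auto)
  ultimately show False using assms(3) by (simp add: mderiv_add mderiv_mult)
qed

context
  fixes \<alpha>1 \<alpha>2 :: "'k::field_char_0 \<Rightarrow> 'k" and a b c :: 'k and F :: "'k poly"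
  assumes idf: "inversive_difference_field \<alpha>1 \<alpha>2"
    and const: "is_constant \<alpha>1 \<alpha>2 a" "is_constant \<alpha>1 \<alpha>2 b" "is_constant \<alpha>1 \<alpha>2 c"
    and c: "c \<noteq> 0" and a: "a \<noteq> 0"
begin

abbreviation Y :: "int \<Rightarrow> int \<Rightarrow> (unit, 'k) spoly" where "Y k l \<equiv> mvar ((k, l), ())"
abbreviation FY :: "int \<Rightarrow> int \<Rightarrow> (unit, 'k) spoly"
  where "FY k l \<equiv> poly (map_poly (\<lambda>d. mconst (gam_act \<alpha>1 \<alpha>2 (k, l) d)) F) (Y k l)"

lemma mvars_FY: "mvars (FY k l) \<subseteq> {((k, l), ())}"
proof -
  interpret coeff_hom "\<lambda>d. mconst (gam_act \<alpha>1 \<alpha>2 (k, l) d)" by (rule coeff_hom_gam_act[OF idf])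
  show ?thesis by (rule mvars_poly_map_poly) simp_all
qed

text \<open>The part of the translated forward scheme that depends on \<open>y\<^sub>k\<^sub>l\<close> only, the translate of \<open>G(y)\<close>.\<close>

definition forward_rest :: "int \<Rightarrow> int \<Rightarrow> (unit, 'k) spoly"
  where "forward_rest k l = FY k l - mconst a * (Y k l * Y k l) - mconst (b + c - 1) * Y k l"

definition forward_translate :: "gam \<Rightarrow> (unit, 'k) spoly"
  where "forward_translate \<gamma> = spoly_act \<alpha>1 \<alpha>2 \<gamma> (forward_scheme a b c F)"

definition symmetric_translate :: "gam \<Rightarrow> (unit, 'k) spoly"
  where "symmetric_translate \<gamma> = spoly_act \<alpha>1 \<alpha>2 \<gamma> (symmetric_scheme a b c F)"

definition symmetric_rest :: "int \<Rightarrow> int \<Rightarrow> (unit, 'k) spoly"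
  where "symmetric_rest k l = (mconst a * Y k l + mconst (b + 1)) * Y (k + 1) l +
      (mconst (1 - b) - mconst a * Y k l) * Y (k - 1) l + FY k l - mconst 2 * Y k l"

lemma forward_translate_eq:
  "forward_translate (k, l) = mconst 1 * Y (k + 2) l + mconst c * Y k (l + 1) +
    ((mconst a * Y k l + mconst (b - 2)) * Y (k + 1) l + forward_rest k l)"
proof -
  interpret coeff_hom "\<lambda>d. mconst (gam_act \<alpha>1 \<alpha>2 (k, l) d)" by (rule coeff_hom_gam_act[OF idf])
  show ?thesis
    unfolding forward_translate_def spoly_act_eq_msubst forward_scheme_def Let_def at_y_def coef_eq_mconst ind_eq_mvar
      forward_rest_def mconst_add mconst_diff mconst_numeral
    by (simp add: msubst_add msubst_diff msubst_mult msubst_power msubst_numeral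
        msubst_poly[OF coeff_hom_gam_act[OF idf]] gam_act_constant[OF idf] const algebra_simps power2_eq_square)
qed

lemma symmetric_translate_eq:
  "symmetric_translate (k, l) = mconst c * Y k (l + 1) + mconst (- c) * Y k (l - 1) + symmetric_rest k l"
proof -
  interpret coeff_hom "\<lambda>d. mconst (gam_act \<alpha>1 \<alpha>2 (k, l) d)" by (rule coeff_hom_gam_act[OF idf])
  show ?thesis
    unfolding symmetric_translate_def spoly_act_eq_msubst symmetric_scheme_def at_y_def coef_eq_mconst ind_eq_mvar
      symmetric_rest_def mconst_add mconst_diff mconst_numeral mconst_uminus
    by (simp add: msubst_add msubst_diff msubst_mult msubst_power msubst_numeral
        msubst_poly[OF coeff_hom_gam_act[OF idf]] gam_act_constant[OF idf] const algebra_simps)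
qed

lemma mvars_forward_rest: "mvars (forward_rest k l) \<subseteq> {((k, l), ())}"
  unfolding forward_rest_def by (intro mvars_subset_arith mvars_FY) simp_all

lemma mvars_symmetric_rest:
  "mvars (symmetric_rest k l) \<subseteq> {((k, l), ()), ((k + 1, l), ()), ((k - 1, l), ())}"
  unfolding symmetric_rest_def
  by (intro mvars_subset_arith mvars_FY[THEN order_trans]) simp_all

lemma mvars_forward:
  "mvars (forward_translate (k, l)) \<subseteq> {((k + 2, l), ()), ((k, l + 1), ()), ((k, l), ()), ((k + 1, l), ())}"
  unfolding forward_translate_eq
  by (intro mvars_subset_arith mvars_forward_rest[THEN order_trans]) simp_all

lemma mvars_symmetric:
  "mvars (symmetric_translate (k, l)) \<subseteq>
    {((k, l + 1), ()), ((k, l - 1), ()), ((k, l), ()), ((k + 1, l), ()), ((k - 1, l), ())}"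
  unfolding symmetric_translate_eq
  by (intro mvars_subset_arith mvars_symmetric_rest[THEN order_trans]) auto

text \<open>Leads with constant coefficients that leave exactly the row \<open>l0\<close> free: upwards \<open>A\<^sub>k\<^sub>l\<close> is
solved for the next row, below the row \<open>l0\<close> it is solved for \<open>y\<^sub>k\<^sub>+\<^sub>2\<^sub>,\<^sub>l\<close>. The rank counts \<open>3\<close> for each row
above \<open>l0\<close> because the step to \<open>y\<^sub>k\<^sub>,\<^sub>l\<^sub>+\<^sub>1\<close> uses \<open>y\<^sub>k\<^sub>+\<^sub>2\<^sub>,\<^sub>l\<close>; below \<open>l0\<close> weight \<open>1\<close> puts \<open>y\<^sub>k\<^sub>,\<^sub>l\<^sub>+\<^sub>1\<close>
under \<open>y\<^sub>k\<^sub>+\<^sub>2\<^sub>,\<^sub>l\<close>. It is unbounded below.\<close>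

lemma forward_row_solvable:
  fixes l0 :: int
  defines "lead \<equiv> \<lambda>(k, l). ((if l \<ge> l0 then (k, l + 1) else (k + 2, l)), ())"
    and "rank \<equiv> \<lambda>((k, l), _). k + (if l \<ge> l0 then 3 * (l - l0) else l - l0)"
  shows "unit_triangular forward_translate lead rank (\<lambda>(k, l). if l \<ge> l0 then c else 1)
    (\<lambda>(k, l). (if l \<ge> l0 then mconst 1 * Y (k + 2) l else mconst c * Y k (l + 1)) +
      ((mconst a * Y k l + mconst (b - 2)) * Y (k + 1) l + forward_rest k l))"
proof
  show "inj lead"
    by (rule injI) (auto simp: lead_def split: if_splits)
next
  fix x :: "gam \<times> unit" and \<gamma> :: gam
  assume x: "x \<in> mvars (forward_translate \<gamma>)" "x \<noteq> lead \<gamma>"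
  obtain k l where \<gamma>: "\<gamma> = (k, l)" by force
  show "rank x < rank (lead \<gamma>)"
    using x mvars_forward[of k l] unfolding \<gamma> lead_def rank_def
    by (cases "l \<ge> l0") (auto split: if_splits)
next
  fix \<gamma> :: gam
  obtain k l where \<gamma>: "\<gamma> = (k, l)" by force
  show "forward_translate \<gamma> = mconst (case \<gamma> of (k, l) \<Rightarrow> if l \<ge> l0 then c else 1) * mvar (lead \<gamma>) +
      (case \<gamma> of (k, l) \<Rightarrow> (if l \<ge> l0 then mconst 1 * Y (k + 2) l else mconst c * Y k (l + 1)) +
      ((mconst a * Y k l + mconst (b - 2)) * Y (k + 1) l + forward_rest k l))"
    unfolding \<gamma> forward_translate_eq lead_def by simp
  show "(case \<gamma> of (k, l) \<Rightarrow> if l \<ge> l0 then c else 1) \<noteq> 0"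
    using c by (simp add: \<gamma>)
  have "mvars (case \<gamma> of (k, l) \<Rightarrow> (if l \<ge> l0 then mconst 1 * Y (k + 2) l else mconst c * Y k (l + 1)) +
      ((mconst a * Y k l + mconst (b - 2)) * Y (k + 1) l + forward_rest k l)) \<subseteq>
      {if l \<ge> l0 then ((k + 2, l), ()) else ((k, l + 1), ()), ((k, l), ()), ((k + 1, l), ())}"
    unfolding \<gamma> prod.case
    by (cases "l \<ge> l0") (simp, intro mvars_subset_arith mvars_forward_rest[THEN order_trans]; auto)+
  then show "lead \<gamma> \<notin> mvars (case \<gamma> of (k, l) \<Rightarrow> (if l \<ge> l0 then mconst 1 * Y (k + 2) l else mconst c * Y k (l + 1)) +
      ((mconst a * Y k l + mconst (b - 2)) * Y (k + 1) l + forward_rest k l))"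
    by (auto simp: lead_def \<gamma> split: if_splits)
qed

text \<open>The row may be chosen freely, and the choice differs from one separant to the other in \<open>forward_separant\<close>.\<close>

lemma
  shows forward_prime: "p * q \<in> lincombs forward_translate \<Longrightarrow> p \<in> lincombs forward_translate \<or> q \<in> lincombs forward_translate"
    and forward_const: "d \<noteq> 0 \<Longrightarrow> mconst d \<notin> lincombs forward_translate"
    and forward_row_free: "p \<in> lincombs forward_translate \<Longrightarrow> mvars p \<subseteq> range (\<lambda>k. ((k, l), ())) \<Longrightarrow> p = 0"
proof -
  interpret unit_triangular forward_translate
    "\<lambda>(k, l'). ((if l' \<ge> l then (k, l' + 1) else (k + 2, l')), ())"
    "\<lambda>((k, l'), _). k + (if l' \<ge> l then 3 * (l' - l) else l' - l)"
    "\<lambda>(k, l'). if l' \<ge> l then c else 1"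
    "\<lambda>(k, l'). (if l' \<ge> l then mconst 1 * Y (k + 2) l' else mconst c * Y k (l' + 1)) +
      ((mconst a * Y k l' + mconst (b - 2)) * Y (k + 1) l' + forward_rest k l')"
    by (rule forward_row_solvable)
  show "p * q \<in> lincombs forward_translate \<Longrightarrow> p \<in> lincombs forward_translate \<or> q \<in> lincombs forward_translate"
    by (rule lincombs_prime)
  show "d \<noteq> 0 \<Longrightarrow> mconst d \<notin> lincombs forward_translate"
    by (rule const_not_in_lincombs)
  show "p = 0" if "p \<in> lincombs forward_translate" "mvars p \<subseteq> range (\<lambda>k. ((k, l), ()))"
    by (rule free_nonleads[OF that(1)]) (use that(2) in \<open>auto split: if_splits\<close>)
qed

text \<open>The lead is an indeterminate of maximal order in \<open>A\<^sub>k\<^sub>l\<close>. For \<open>k = -1\<close> and \<open>l < 0\<close> both \<open>y\<^sub>k\<^sub>l\<close> and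
\<open>y\<^sub>k\<^sub>+\<^sub>2\<^sub>,\<^sub>l\<close> have maximal order, and the linear one is chosen. The non-leads are the points with \<open>k = 0\<close>,
with \<open>k = 1\<close> and \<open>l \<ge> 0\<close>, with \<open>k < 0\<close> and \<open>l = 0\<close>, and with \<open>k = -1\<close> and \<open>l < 0\<close>.\<close>

definition forward_lead :: "gam \<Rightarrow> gam \<times> unit"
  where "forward_lead = (\<lambda>(k, l).
    (if k \<ge> 0 \<or> k = -1 \<and> l < 0 then (k + 2, l) else if l \<ge> 0 then (k, l + 1) else (k, l), ()))"

text \<open>The leads are determined column by column for \<open>k \<ge> 0\<close>, row by row for \<open>k < 0\<close> and \<open>l \<ge> 1\<close>, and by
antidiagonals for \<open>k \<le> -2\<close> and \<open>l < 0\<close>. The rows start with rank \<open>2\<close> because the first of them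
is computed from points with \<open>k = 1\<close>, which have rank \<open>1\<close>.\<close>

definition forward_rank :: "gam \<times> unit \<Rightarrow> nat"
  where "forward_rank = (\<lambda>((k, l), _).
    nat (if k \<ge> 0 then k else if l \<ge> 1 then l + 1 else if k \<le> -2 \<and> l < 0 then - k - l else 0))"

text \<open>The third case is the nonlinear one: the separant is a polynomial in two neighbours of one row,
in which \<open>y\<^sub>k\<^sub>+\<^sub>1\<^sub>,\<^sub>l\<close> occurs linearly with the coefficient \<open>a \<noteq> 0\<close>.\<close>

lemma forward_separant:
  "mpartial (forward_lead \<gamma>) (forward_translate \<gamma>) \<notin> lincombs forward_translate"
proof -
  obtain k l where \<gamma>: "\<gamma> = (k, l)" by force
  have rest: "mpartial x (forward_rest k l) = 0" if "x \<noteq> ((k, l), ())" for x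
    by (rule mderiv_eq_0) (use that mvars_forward_rest[of k l] in auto)
  have "forward_lead \<gamma> = ((k + 2, l), ()) \<or> forward_lead \<gamma> = ((k, l + 1), ()) \<or>
      forward_lead \<gamma> = ((k, l), ())"
    unfolding forward_lead_def \<gamma> prod.case by presburger
  then consider "forward_lead \<gamma> = ((k + 2, l), ())" | "forward_lead \<gamma> = ((k, l + 1), ())" |
      "forward_lead \<gamma> = ((k, l), ())"
    by blast
  then show ?thesis
  proof cases
    case 1
    then have "mpartial (forward_lead \<gamma>) (forward_translate \<gamma>) = mconst 1"
      unfolding \<gamma> forward_translate_eq by (simp add: mderiv_add mderiv_mult rest)
    then show ?thesis using forward_const[of 1] by simp
  next
    case 2
    then have "mpartial (forward_lead \<gamma>) (forward_translate \<gamma>) = mconst c"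
      unfolding \<gamma> forward_translate_eq by (simp add: mderiv_add mderiv_mult rest)
    then show ?thesis using forward_const[of c] c by simp
  next
    case 3
    let ?s = "mconst a * Y (k + 1) l + mpartial ((k, l), ()) (forward_rest k l)"
    have "mpartial (forward_lead \<gamma>) (forward_translate \<gamma>) = ?s"
      using 3 unfolding \<gamma> forward_translate_eq by (simp add: mderiv_add mderiv_mult)
    moreover have "?s \<noteq> 0"
      by (rule linear_in_fresh_variable_nonzero[OF mvars_mpartial[OF mvars_forward_rest] _ a]) simp
    moreover have "mvars ?s \<subseteq> range (\<lambda>k. ((k, l), ()))"
      by (intro mvars_subset_arith mvars_mpartial mvars_forward_rest[THEN order_trans]) auto
    ultimately show ?thesis using forward_row_free by metis
  qed
qed

lemma forward_separable: "separable_triangular forward_translate forward_lead forward_rank"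
proof
  show "inj forward_lead"
    by (rule injI) (auto simp: forward_lead_def split: if_splits)
next
  fix x :: "gam \<times> unit" and \<gamma> :: gam
  assume x: "x \<in> mvars (forward_translate \<gamma>)" "x \<noteq> forward_lead \<gamma>"
  obtain k l where \<gamma>: "\<gamma> = (k, l)" by force
  show "forward_rank x < forward_rank (forward_lead \<gamma>)"
    using x mvars_forward[of k l] unfolding \<gamma> forward_lead_def forward_rank_def
    by (auto split: if_splits)
next
  show "1 \<notin> lincombs forward_translate" using forward_const[of 1] by simp
qed (rule forward_prime forward_separant; assumption?)+

lemma forward_closed:
  assumes "forward_lead \<gamma> \<in> Gam r \<times> UNIV"
  shows "mvars (forward_translate \<gamma>) \<subseteq> Gam r \<times> UNIV"
proof -
  obtain k l where \<gamma>: "\<gamma> = (k, l)" by force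
  have "{((k + 2, l), ()), ((k, l + 1), ()), ((k, l), ()), ((k + 1, l), ())} \<subseteq> Gam r \<times> UNIV"
    using assms unfolding \<gamma> forward_lead_def by (auto simp: Gam_def gam_ord_def split: if_splits)
  then show ?thesis using mvars_forward[of k l] unfolding \<gamma> by blast
qed

lemma card_forward_basis:
  assumes "r \<ge> 1"
  shows "card (Gam r \<times> UNIV - range forward_lead) = 5 * r"
proof -
  let ?r = "int r"
  have range: "((k, l), ()) \<in> range forward_lead \<longleftrightarrow>
    k \<ge> 2 \<and> l \<ge> 0 \<or> k \<le> -1 \<and> l \<ge> 1 \<or> k \<le> -2 \<and> l < 0 \<or> k \<ge> 1 \<and> l < 0" for k l
  proof
    assume "k \<ge> 2 \<and> l \<ge> 0 \<or> k \<le> -1 \<and> l \<ge> 1 \<or> k \<le> -2 \<and> l < 0 \<or> k \<ge> 1 \<and> l < 0"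
    then have "((k, l), ()) = forward_lead (k - 2, l) \<or> ((k, l), ()) = forward_lead (k, l - 1) \<or>
      ((k, l), ()) = forward_lead (k, l)"
      by (auto simp: forward_lead_def)
    then show "((k, l), ()) \<in> range forward_lead" by blast
  qed (auto simp: forward_lead_def split: if_splits)
  have basis: "Gam r \<times> UNIV - range forward_lead = (\<lambda>\<gamma>. (\<gamma>, ())) `
    ({0} \<times> {- ?r..?r} \<union> {1} \<times> {0..?r - 1} \<union> {- ?r..-1} \<times> {0} \<union> {-1} \<times> {1 - ?r..-1})" (is "_ = _ ` ?B")
  proof (rule Set.set_eqI, rule iffI)
    fix x assume "x \<in> Gam r \<times> (UNIV :: unit set) - range forward_lead"
    then obtain k l where x: "x = ((k, l), ())" "(k, l) \<in> Gam r" "((k, l), ()) \<notin> range forward_lead"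
      by auto
    then have "\<bar>k\<bar> + \<bar>l\<bar> \<le> ?r"
        "\<not> (k \<ge> 2 \<and> l \<ge> 0 \<or> k \<le> -1 \<and> l \<ge> 1 \<or> k \<le> -2 \<and> l < 0 \<or> k \<ge> 1 \<and> l < 0)"
      unfolding range by (simp_all add: Gam_def gam_ord_def)
    then have "k = 0 \<and> - ?r \<le> l \<and> l \<le> ?r \<or> k = 1 \<and> 0 \<le> l \<and> l \<le> ?r - 1 \<or>
        (- ?r \<le> k \<and> k \<le> -1) \<and> l = 0 \<or> k = -1 \<and> 1 - ?r \<le> l \<and> l \<le> -1"
      by (smt (verit))
    then have "(k, l) \<in> ?B" by auto
    then show "x \<in> (\<lambda>\<gamma>. (\<gamma>, ())) ` ?B" using x(1) by blast
  next
    fix x assume "x \<in> (\<lambda>\<gamma>. (\<gamma>, ())) ` ?B"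
    then obtain k l where x: "x = ((k, l), ())" "(k, l) \<in> ?B" by force
    then have "k = 0 \<and> - ?r \<le> l \<and> l \<le> ?r \<or> k = 1 \<and> 0 \<le> l \<and> l \<le> ?r - 1 \<or>
        (- ?r \<le> k \<and> k \<le> -1) \<and> l = 0 \<or> k = -1 \<and> 1 - ?r \<le> l \<and> l \<le> -1"
      by simp
    then have "\<bar>k\<bar> + \<bar>l\<bar> \<le> ?r \<and>
        \<not> (k \<ge> 2 \<and> l \<ge> 0 \<or> k \<le> -1 \<and> l \<ge> 1 \<or> k \<le> -2 \<and> l < 0 \<or> k \<ge> 1 \<and> l < 0)"
      using assms by (smt (verit) of_nat_1 of_nat_mono)
    then have "(k, l) \<in> Gam r \<and> ((k, l), ()) \<notin> range forward_lead"
      unfolding range by (simp add: Gam_def gam_ord_def)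
    then show "x \<in> Gam r \<times> UNIV - range forward_lead" using x(1) by simp
  qed
  have "card ((\<lambda>\<gamma>. (\<gamma>, ())) ` ?B) = card ?B"
    by (rule card_image) (simp add: inj_on_def)
  also have "\<dots> = 5 * r"
  proof -
    have union: "card (S \<union> T) = card S + card T"
      if "finite S" "finite T" "S \<inter> T = {}" for S T :: "gam set"
      by (rule card_Un_disjoint[OF that])
    let ?C = "{0::int} \<times> {- ?r..?r}" and ?D = "{1::int} \<times> {0..?r - 1}"
      and ?E = "{- ?r..-1} \<times> {0::int}" and ?F = "{-1::int} \<times> {1 - ?r..-1}"
    have "card (?C \<union> ?D \<union> ?E \<union> ?F) = card (?C \<union> ?D \<union> ?E) + card ?F"
      by (rule union) (simp, simp, fastforce)
    also have "card (?C \<union> ?D \<union> ?E) = card (?C \<union> ?D) + card ?E"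
      by (rule union) (simp, simp, fastforce)
    also have "card (?C \<union> ?D) = card ?C + card ?D"
      by (rule union) (simp, simp, fastforce)
    finally show ?thesis using assms by (simp add: card_cartesian_product)
  qed
  finally show ?thesis unfolding basis .
qed

text \<open>Upwards and downwards the symmetric scheme is solved with the coefficients \<open>c\<close> and \<open>-c\<close>, so the same leads
serve for primality and for the count.\<close>

definition symmetric_lead :: "gam \<Rightarrow> gam \<times> unit"
  where "symmetric_lead = (\<lambda>(k, l). ((k, if l \<ge> 0 then l + 1 else l - 1), ()))"

definition symmetric_rank :: "gam \<times> unit \<Rightarrow> nat"
  where "symmetric_rank = (\<lambda>((k, l), _). nat (if l \<ge> 0 then l else - 1 - l))"

lemma symmetric_triangular: "triangular symmetric_translate symmetric_lead symmetric_rank"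
proof
  show "inj symmetric_lead"
    by (rule injI) (auto simp: symmetric_lead_def split: if_splits)
next
  fix x :: "gam \<times> unit" and \<gamma> :: gam
  assume x: "x \<in> mvars (symmetric_translate \<gamma>)" "x \<noteq> symmetric_lead \<gamma>"
  obtain k l where \<gamma>: "\<gamma> = (k, l)" by force
  show "symmetric_rank x < symmetric_rank (symmetric_lead \<gamma>)"
    using x mvars_symmetric[of k l] unfolding \<gamma> symmetric_lead_def symmetric_rank_def
    by (auto split: if_splits)
qed

lemma symmetric_separable: "separable_triangular symmetric_translate symmetric_lead symmetric_rank"
proof -
  define e where "e = (\<lambda>\<gamma>::gam. if snd \<gamma> \<ge> 0 then c else - c)"
  define B where "B = (\<lambda>(k, l). (if l \<ge> 0 then mconst (- c) * Y k (l - 1) else mconst c * Y k (l + 1)) +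
    symmetric_rest k l)"
  have B: "mvars (B (k, l)) \<subseteq> {(if l \<ge> 0 then ((k, l - 1), ()) else ((k, l + 1), ())),
      ((k, l), ()), ((k + 1, l), ()), ((k - 1, l), ())}" for k l
    unfolding B_def prod.case
    by (cases "l \<ge> 0") (simp, intro mvars_subset_arith mvars_symmetric_rest[THEN order_trans]; auto)+
  interpret unit_triangular symmetric_translate symmetric_lead symmetric_rank e B
  proof (rule unit_triangular.intro[OF symmetric_triangular], standard)
    fix \<gamma> :: gam
    obtain k l where \<gamma>: "\<gamma> = (k, l)" by force
    show "symmetric_translate \<gamma> = mconst (e \<gamma>) * mvar (symmetric_lead \<gamma>) + B \<gamma>"
      unfolding \<gamma> symmetric_translate_eq by (simp add: e_def B_def symmetric_lead_def algebra_simps)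
    show "e \<gamma> \<noteq> 0" using c by (simp add: e_def)
    show "symmetric_lead \<gamma> \<notin> mvars (B \<gamma>)"
      using B[of k l] unfolding \<gamma> symmetric_lead_def by (auto split: if_splits)
  qed
  show ?thesis
  proof (rule separable_triangular.intro[OF symmetric_triangular], standard)
    show "1 \<notin> lincombs symmetric_translate" using const_not_in_lincombs[of 1] by simp
    fix \<gamma> :: gam
    have "mpartial (symmetric_lead \<gamma>) (B \<gamma>) = 0"
      by (rule mderiv_eq_0) (use lead_not_in_B[of \<gamma>] in auto)
    then have "mpartial (symmetric_lead \<gamma>) (symmetric_translate \<gamma>) = mconst (e \<gamma>)"
      by (simp add: solved mderiv_add mderiv_mult)
    then show "mpartial (symmetric_lead \<gamma>) (symmetric_translate \<gamma>) \<notin> lincombs symmetric_translate"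
      using const_not_in_lincombs[OF e_nonzero] by simp
  qed (rule lincombs_prime)
qed

lemma symmetric_closed:
  assumes "symmetric_lead \<gamma> \<in> Gam r \<times> UNIV"
  shows "mvars (symmetric_translate \<gamma>) \<subseteq> Gam r \<times> UNIV"
proof -
  obtain k l where \<gamma>: "\<gamma> = (k, l)" by force
  have "{((k, l + 1), ()), ((k, l - 1), ()), ((k, l), ()), ((k + 1, l), ()), ((k - 1, l), ())} \<subseteq> Gam r \<times> UNIV"
    using assms unfolding \<gamma> symmetric_lead_def by (auto simp: Gam_def gam_ord_def split: if_splits)
  then show ?thesis using mvars_symmetric[of k l] unfolding \<gamma> by blast
qed

lemma card_symmetric_basis:
  assumes "r \<ge> 1"
  shows "card (Gam r \<times> UNIV - range symmetric_lead) = 4 * r"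
proof -
  let ?r = "int r"
  have range: "((k, l), ()) \<in> range symmetric_lead \<longleftrightarrow> l \<ge> 1 \<or> l \<le> -2" for k l
  proof
    assume "l \<ge> 1 \<or> l \<le> -2"
    then have "((k, l), ()) = symmetric_lead (k, l - 1) \<or> ((k, l), ()) = symmetric_lead (k, l + 1)"
      by (auto simp: symmetric_lead_def)
    then show "((k, l), ()) \<in> range symmetric_lead" by blast
  qed (auto simp: symmetric_lead_def split: if_splits)
  have basis: "Gam r \<times> UNIV - range symmetric_lead = (\<lambda>\<gamma>. (\<gamma>, ())) `
    ({- ?r..?r} \<times> {0} \<union> {1 - ?r..?r - 1} \<times> {-1})" (is "_ = _ ` ?B")
  proof (rule Set.set_eqI, rule iffI)
    fix x assume "x \<in> Gam r \<times> (UNIV :: unit set) - range symmetric_lead"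
    then obtain k l where x: "x = ((k, l), ())" "(k, l) \<in> Gam r" "((k, l), ()) \<notin> range symmetric_lead"
      by auto
    then have "(k, l) \<in> ?B" unfolding range by (auto simp: Gam_def gam_ord_def)
    then show "x \<in> (\<lambda>\<gamma>. (\<gamma>, ())) ` ?B" using x(1) by blast
  next
    fix x assume "x \<in> (\<lambda>\<gamma>. (\<gamma>, ())) ` ?B"
    then obtain k l where x: "x = ((k, l), ())" "(k, l) \<in> ?B" by force
    then have "(k, l) \<in> Gam r \<and> ((k, l), ()) \<notin> range symmetric_lead"
      unfolding range using assms by (auto simp: Gam_def gam_ord_def)
    then show "x \<in> Gam r \<times> UNIV - range symmetric_lead" using x(1) by simp
  qed
  have "card ((\<lambda>\<gamma>. (\<gamma>, ())) ` ?B) = card ?B"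
    by (rule card_image) (simp add: inj_on_def)
  also have "\<dots> = 4 * r"
    using assms by (subst card_Un_disjoint, simp, simp, force) (simp add: card_cartesian_product)
  finally show ?thesis unfolding basis .
qed

lemma dimension_forward: "is_dimension_polynomial \<alpha>1 \<alpha>2 {forward_scheme a b c F} [:0, 5:]"
proof (rule is_dimension_polynomial_if_separable[where N = 1])
  show "separable_triangular (\<lambda>\<gamma>. spoly_act \<alpha>1 \<alpha>2 \<gamma> (forward_scheme a b c F)) forward_lead forward_rank"
    using forward_separable by (simp flip: forward_translate_def)
  show "mvars (spoly_act \<alpha>1 \<alpha>2 \<gamma> (forward_scheme a b c F)) \<subseteq> Gam r \<times> UNIV"
    if "forward_lead \<gamma> \<in> Gam r \<times> UNIV" for r \<gamma>
    using forward_closed[OF that] by (simp flip: forward_translate_def)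
  show "poly [:0, 5:] (of_nat r) = (of_nat (card (Gam r \<times> UNIV - range forward_lead)) :: rat)"
    if "1 \<le> r" for r
    unfolding card_forward_basis[OF that] by simp
qed

lemma dimension_symmetric: "is_dimension_polynomial \<alpha>1 \<alpha>2 {symmetric_scheme a b c F} [:0, 4:]"
proof (rule is_dimension_polynomial_if_separable[where N = 1])
  show "separable_triangular (\<lambda>\<gamma>. spoly_act \<alpha>1 \<alpha>2 \<gamma> (symmetric_scheme a b c F)) symmetric_lead symmetric_rank"
    using symmetric_separable by (simp flip: symmetric_translate_def)
  show "mvars (spoly_act \<alpha>1 \<alpha>2 \<gamma> (symmetric_scheme a b c F)) \<subseteq> Gam r \<times> UNIV"
    if "symmetric_lead \<gamma> \<in> Gam r \<times> UNIV" for r \<gamma>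
    using symmetric_closed[OF that] by (simp flip: symmetric_translate_def)
  show "poly [:0, 4:] (of_nat r) = (of_nat (card (Gam r \<times> UNIV - range symmetric_lead)) :: rat)"
    if "1 \<le> r" for r
    unfolding card_symmetric_basis[OF that] by simp
qed

end

theorem mainTheorem4:
  fixes \<alpha>1 \<alpha>2 :: "'k::field_char_0 \<Rightarrow> 'k"
    and val :: "'k \<Rightarrow> 'x::comm_ring_1 \<Rightarrow> 'x \<Rightarrow> 'v"
    and a b c :: 'k
    and F :: "'k poly"
  assumes "inversive_difference_field \<alpha>1 \<alpha>2"
    and "elements_are_functions \<alpha>1 \<alpha>2 val"
    and "is_constant \<alpha>1 \<alpha>2 a" and "is_constant \<alpha>1 \<alpha>2 b" and "is_constant \<alpha>1 \<alpha>2 c"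
    and "c \<noteq> 0" and "a * b \<noteq> 0"
  shows "is_dimension_polynomial \<alpha>1 \<alpha>2 {forward_scheme a b c F} [:0, 5:] \<and>
         is_dimension_polynomial \<alpha>1 \<alpha>2 {symmetric_scheme a b c F} [:0, 4:]"
proof -
  have "a \<noteq> 0" using assms(7) by simp
  then show ?thesis
    using dimension_forward[OF assms(1,3-6)] dimension_symmetric[OF assms(1,3-6)] by simp
qed

end
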